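(* Suppose that $\{X_n;n\ge1\}$ is a sequence of independent and identically distributed random variables in a sub-linear expectation space $(\Omega,\mathscr H,\widehat{\mathbb E})$ with $\widehat{\mathbb E}[X_1]=\widehat{\mathbb E}[-X_1]=0$ and $\lim_{c\to\infty}\widehat{\mathbb E}[(X_1^2-c)^+]=0$. Write $S_n=\sum_{k=1}^nX_k$, $\overline\sigma^2=\widehat{\mathbb E}[X_1^2]$ and $\underline\sigma^2=\widehat{\mathcal E}[X_1^2]$ (with $\overline\sigma,\underline\sigma\ge0$). Let $\{y_n\}$ be a sequence of positive numbers such that $y_n\to\infty$ and $y_n/\sqrt n\to0$. Then: (a) for any $|b|<\underline\sigma$, $\epsilon>0$ and $\delta>0$ with $(b/\underline\sigma)^2+\delta<1$, there exists $n_0$ such that $$\mathcal V\left(\Big|\frac{S_n}{y_n\sqrt n}-b\Big|\le\epsilon\right)\ge\exp\left\{-\left(\Big(\frac{|b|}{\underline\sigma}\Big)^2+\delta\right)\frac{y_n^2}{2}\right\},\qquad\forall n\ge n_0;$$ (b) for any $|b|<\overline\sigma$, $\epsilon>0$ and $\delta>0$ with $(b/\overline\sigma)^2+\delta<1$, there exists $n_0$ such that $$\mathbb V\left(\Big|\frac{S_n}{y_n\sqrt n}-b\Big|\le\epsilon\right)\ge\exp\left\{-\left(\Big(\frac{|b|}{\overline\sigma}\Big)^2+\delta\right)\frac{y_n^2}{2}\right\},\qquad\forall n\ge n_0.$$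
   Context: Let $(\Omega,\mathcal F)$ be a measurable space and $\mathscr H$ a linear space of real-valued $\mathcal F$-measurable functions on $\Omega$ such that $\varphi(X_1,\ldots,X_n)\in\mathscr H$ whenever $X_1,\ldots,X_n\in\mathscr H$ and $\varphi\in C_{l,Lip}(\mathbb R^n)$, where $C_{l,Lip}(\mathbb R^n)$ is the space of functions $\varphi:\mathbb R^n\to\mathbb R$ with $|\varphi(x)-\varphi(y)|\le C(1+|x|^m+|y|^m)|x-y|$ for all $x,y\in\mathbb R^n$, for some $C>0$, $m\in\mathbb N$ depending on $\varphi$. Elements of $\mathscr H$ are called random variables. A sub-linear expectation is a map $\widehat{\mathbb E}:\mathscr H\to[-\infty,\infty]$ such that for all $X,Y\in\mathscr H$: $X\ge Y$ implies $\widehat{\mathbb E}[X]\ge\widehat{\mathbb E}[Y]$; $\widehat{\mathbb E}[c]=c$ for constants $c$; $\widehat{\mathbb E}[X+Y]\le\widehat{\mathbb E}[X]+\widehat{\mathbb E}[Y]$ whenever the right side is not of the form $+\infty-\infty$ or $-\infty+\infty$; $\widehat{\mathbb E}[\lambda X]=\lambda\widehat{\mathbb E}[X]$ for $\lambda\ge0$. The triple $(\Omega,\mathscr H,\widehat{\mathbb E})$ is a sub-linear expectation space. The conjugate expectation is $\widehat{\mathcal E}[X]=-\widehat{\mathbb E}[-X]$. Capacities: $\mathbb V(A)=\inf\{\widehat{\mathbb E}[\xi]: I_A\le\xi,\ \xi\in\mathscr H\}$ and $\mathcal V(A)=1-\mathbb V(A^c)$ for $A\in\mathcal F$. Independence: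 a random vector $\boldsymbol Y=(Y_1,\ldots,Y_n)$ (with $Y_i\in\mathscr H$) is independent to $\boldsymbol X=(X_1,\ldots,X_m)$ (with $X_i\in\mathscr H$) if for each $\varphi\in C_{l,Lip}(\mathbb R^m\times\mathbb R^n)$, $\widehat{\mathbb E}[\varphi(\boldsymbol X,\boldsymbol Y)]=\widehat{\mathbb E}\big[\widehat{\mathbb E}[\varphi(\boldsymbol x,\boldsymbol Y)]\big|_{\boldsymbol x=\boldsymbol X}\big]$ whenever $\overline\varphi(\boldsymbol x):=\widehat{\mathbb E}[|\varphi(\boldsymbol x,\boldsymbol Y)|]<\infty$ for all $\boldsymbol x$ and $\widehat{\mathbb E}[|\overline\varphi(\boldsymbol X)|]<\infty$. The sequence $\{X_n;n\ge1\}$ is independent and identically distributed if for each $i\ge1$: $X_{i+1}$ is independent to $(X_1,\ldots,X_i)$, and $X_i\overset{d}=X_1$, i.e. $\widehat{\mathbb E}[\varphi(X_i)]=\widehat{\mathbb E}[\varphi(X_1)]$ for all $\varphi\in C_{l,Lip}(\mathbb R)$ whenever the sub-linear expectations are finite. *)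

theory Defs
  imports "HOL-Analysis.Analysis"
begin

text \<open>
  The functions on n-dimensional Euclidean space whose local Lipschitz constants grow polynomially.
  Since n varies inside the later definitions, a vector is a function on \<^typ>\<open>nat\<close> of which only
  the components with index below n count. The estimate is required for all such functions, so it
  forces \<open>\<phi>\<close> to ignore the remaining components (see \<open>C_lLip_cong\<close> below), and \<open>C_lLip n\<close>
  corresponds bijectively to the usual space of functions of n real variables.
\<close>

definition C_lLip :: "nat \<Rightarrow> ((nat \<Rightarrow> real) \<Rightarrow> real) set" where
  "C_lLip n = {\<phi>. \<exists>C>0. \<exists>m::nat. \<forall>x y.
     \<bar>\<phi> x - \<phi> y\<bar> \<le> C * (1 + L2_set x {..<n} ^ m + L2_set y {..<n} ^ m)
                    * L2_set (\<lambda>i. x i - y i) {..<n}}"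

lemma C_lLip_cong:
  assumes "\<phi> \<in> C_lLip n" and "\<And>i. i < n \<Longrightarrow> x i = y i"
  shows "\<phi> x = \<phi> y"
proof -
  have 0: "L2_set (\<lambda>i. x i - y i) {..<n} = 0"
    using assms(2) by (simp add: L2_set_eq_0_iff)
  obtain C m where
    "\<bar>\<phi> x - \<phi> y\<bar> \<le> C * (1 + L2_set x {..<n} ^ m + L2_set y {..<n} ^ m)
                    * L2_set (\<lambda>i. x i - y i) {..<n}"
    using assms(1) unfolding C_lLip_def by blast
  then show ?thesis
    unfolding 0 by simp
qed

text \<open>
  \<open>M\<close> carries only the measurable space (its measure is irrelevant). The functional \<open>E\<close> is
  total in the logic, but only its values on \<open>H\<close> are meaningful. Functions are compared
  pointwise on \<^term>\<open>space M\<close>, so monotonicity makes \<open>E\<close> independent of the values outside it.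
\<close>

locale sublinear_expectation_space =
  fixes M :: "'a measure"
    and H :: "('a \<Rightarrow> real) set"
    and E :: "('a \<Rightarrow> real) \<Rightarrow> ereal"
  assumes H_measurable: "X \<in> H \<Longrightarrow> X \<in> borel_measurable M"
    and H_zero: "(\<lambda>_. 0) \<in> H"
    and H_add: "X \<in> H \<Longrightarrow> Y \<in> H \<Longrightarrow> (\<lambda>\<omega>. X \<omega> + Y \<omega>) \<in> H"
    and H_scale: "X \<in> H \<Longrightarrow> (\<lambda>\<omega>. c * X \<omega>) \<in> H"
    and H_compose: "(\<And>i. i < n \<Longrightarrow> Xs i \<in> H) \<Longrightarrow> \<phi> \<in> C_lLip n \<Longrightarrow> (\<lambda>\<omega>. \<phi> (\<lambda>i. Xs i \<omega>)) \<in> H"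
    and E_mono: "X \<in> H \<Longrightarrow> Y \<in> H \<Longrightarrow> (\<And>\<omega>. \<omega> \<in> space M \<Longrightarrow> Y \<omega> \<le> X \<omega>) \<Longrightarrow> E Y \<le> E X"
    and E_const: "E (\<lambda>_. c) = ereal c"
    and E_subadd: "X \<in> H \<Longrightarrow> Y \<in> H \<Longrightarrow>
           \<not> (E X = \<infinity> \<and> E Y = -\<infinity>) \<Longrightarrow> \<not> (E X = -\<infinity> \<and> E Y = \<infinity>) \<Longrightarrow>
           E (\<lambda>\<omega>. X \<omega> + Y \<omega>) \<le> E X + E Y"
    and E_pos_homog: "X \<in> H \<Longrightarrow> 0 \<le> c \<Longrightarrow> E (\<lambda>\<omega>. c * X \<omega>) = ereal c * E X"

definition conjugate_expectation :: "(('a \<Rightarrow> real) \<Rightarrow> ereal) \<Rightarrow> ('a \<Rightarrow> real) \<Rightarrow> ereal" where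
  "conjugate_expectation E X = - E (\<lambda>\<omega>. - X \<omega>)"

definition upper_capacity ::
  "'a measure \<Rightarrow> ('a \<Rightarrow> real) set \<Rightarrow> (('a \<Rightarrow> real) \<Rightarrow> ereal) \<Rightarrow> 'a set \<Rightarrow> ereal" where
  "upper_capacity M H E A = Inf {E \<xi> | \<xi>. \<xi> \<in> H \<and> (\<forall>\<omega>\<in>space M. indicator A \<omega> \<le> \<xi> \<omega>)}"

definition lower_capacity ::
  "'a measure \<Rightarrow> ('a \<Rightarrow> real) set \<Rightarrow> (('a \<Rightarrow> real) \<Rightarrow> ereal) \<Rightarrow> 'a set \<Rightarrow> ereal" where
  "lower_capacity M H E A = 1 - upper_capacity M H E (space M - A)"

text \<open>The concatenation of an m-dimensional vector \<open>x\<close> with a vector \<open>y\<close>.\<close>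

definition vec_append :: "nat \<Rightarrow> (nat \<Rightarrow> real) \<Rightarrow> (nat \<Rightarrow> real) \<Rightarrow> nat \<Rightarrow> real" where
  "vec_append m x y i = (if i < m then x i else y (i - m))"

text \<open>
  The n-dimensional random vector \<open>Y\<close> is independent to the m-dimensional random vector \<open>X\<close>.
  In the defining identity, \<open>E\<close> is applied to functions of \<open>X\<close> that are themselves obtained
  from \<open>E\<close>. These need not lie in \<open>H\<close> in general; the identity is demanded exactly when
  they do, i.e. when all its terms are defined. The coercion to real numbers loses nothing:
  if \<open>\<phi>bar\<close> is finite everywhere then so is \<open>\<phi>hat\<close>.
\<close>

definition indep_to ::
  "('a \<Rightarrow> real) set \<Rightarrow> (('a \<Rightarrow> real) \<Rightarrow> ereal) \<Rightarrow>
   nat \<Rightarrow> (nat \<Rightarrow> 'a \<Rightarrow> real) \<Rightarrow> nat \<Rightarrow> (nat \<Rightarrow> 'a \<Rightarrow> real) \<Rightarrow> bool" where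
  "indep_to H E n Y m X \<longleftrightarrow>
     (\<forall>i<n. Y i \<in> H) \<and> (\<forall>i<m. X i \<in> H) \<and>
     (\<forall>\<phi> \<in> C_lLip (m + n).
        let \<phi>hat = (\<lambda>x. E (\<lambda>\<omega>. \<phi> (vec_append m x (\<lambda>i. Y i \<omega>))));
            \<phi>bar = (\<lambda>x. E (\<lambda>\<omega>. \<bar>\<phi> (vec_append m x (\<lambda>i. Y i \<omega>))\<bar>));
            hatX = (\<lambda>\<omega>. real_of_ereal (\<phi>hat (\<lambda>i. X i \<omega>)));
            barX = (\<lambda>\<omega>. \<bar>real_of_ereal (\<phi>bar (\<lambda>i. X i \<omega>))\<bar>)
        in (\<forall>x. \<phi>bar x < \<infinity>) \<longrightarrow> barX \<in> H \<longrightarrow> hatX \<in> H \<longrightarrow> E barX < \<infinity> \<longrightarrow>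
           E (\<lambda>\<omega>. \<phi> (vec_append m (\<lambda>i. X i \<omega>) (\<lambda>i. Y i \<omega>))) = E hatX)"

definition identically_distributed ::
  "(('a \<Rightarrow> real) \<Rightarrow> ereal) \<Rightarrow> ('a \<Rightarrow> real) \<Rightarrow> ('a \<Rightarrow> real) \<Rightarrow> bool" where
  "identically_distributed E X Y \<longleftrightarrow>
     (\<forall>\<phi> \<in> C_lLip 1. \<bar>E (\<lambda>\<omega>. \<phi> (\<lambda>_. X \<omega>))\<bar> \<noteq> \<infinity> \<longrightarrow> \<bar>E (\<lambda>\<omega>. \<phi> (\<lambda>_. Y \<omega>))\<bar> \<noteq> \<infinity> \<longrightarrow>
        E (\<lambda>\<omega>. \<phi> (\<lambda>_. X \<omega>)) = E (\<lambda>\<omega>. \<phi> (\<lambda>_. Y \<omega>)))"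

text \<open>
  Sequences of random variables start at index 1 (\<open>X 0\<close> is ignored), whereas the components of
  a vector are numbered from 0; hence \<open>\<lambda>j. X (Suc j)\<close> is the vector (X 1, ..., X i).
\<close>

definition iid_sequence ::
  "('a \<Rightarrow> real) set \<Rightarrow> (('a \<Rightarrow> real) \<Rightarrow> ereal) \<Rightarrow> (nat \<Rightarrow> 'a \<Rightarrow> real) \<Rightarrow> bool" where
  "iid_sequence H E X \<longleftrightarrow>
     (\<forall>i\<ge>1. X i \<in> H \<and>
        indep_to H E 1 (\<lambda>_. X (Suc i)) i (\<lambda>j. X (Suc j)) \<and>
        identically_distributed E (X i) (X 1))"

end

theory Submission
  imports Defs
begin

text \<open>
  Let \<open>F\<close> be \<open>E\<close> or its conjugate, \<open>F[X\<^sub>1\<^sup>2] = \<sigma>\<^sup>2\<close>. By independence, \<open>F[g(S\<^sub>n)]\<close> is the n-fold iterate at 0 of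
  the transition operator \<open>T g s = F[g(s + X\<^sub>1)]\<close>, which is bounded below by comparison with a
  subsolution: the Gaussian kernel
  \<open>u(t, x) = exp(-y\<^sup>2 (x - b)\<^sup>2 / (2 \<sigma>\<^sup>2 (\<tau> + 1 - t)) - \<delta> y\<^sup>2 (1 - t))\<close>, \<open>x = s / (y n\<^sup>1\<^sup>/\<^sup>2)\<close>.
  Its exponent without the \<open>\<delta>\<close>-term solves the Hamilton-Jacobi equation of the rate function, its
  concave part is negligible on the scale of moderate deviations (so that only \<open>\<sigma>\<^sup>2\<close> matters for either
  functional), and \<open>\<delta>\<close> absorbs the Taylor error by the Lindeberg-type tail
  condition. The constant \<open>exp(-y\<^sup>2 P)\<close> is subtracted from \<open>u\<close>: then the comparison is only needed for
  bounded \<open>x\<close>, and for small \<open>\<tau>\<close> the terminal value lies below the indicator of \<open>|x - b| \<le> \<epsilon>\<close>.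
\<close>

section \<open>Elementary estimates for exponentials and truncated squares\<close>

lemma exp_ge_quadratic_minus_cubic:
  fixes w R :: real
  assumes "\<bar>w\<bar> \<le> R"
  shows "1 + w + w\<^sup>2 / 2 - exp R * \<bar>w\<bar> ^ 3 \<le> exp w"
proof -
  obtain t where t: "\<bar>t\<bar> \<le> \<bar>w\<bar>" "exp w = (\<Sum>m<3. w ^ m / fact m) + exp t / fact 3 * w ^ 3"
    using Maclaurin_exp_le[of w 3] by blast
  have "exp t \<le> exp R" using t(1) assms by simp
  then have "exp t / 6 * \<bar>w\<bar> ^ 3 \<le> exp R * \<bar>w\<bar> ^ 3"
    by (intro mult_right_mono) (use exp_gt_zero[of t] in linarith, simp)
  moreover have "- (exp t / 6 * w ^ 3) \<le> exp t / 6 * \<bar>w\<bar> ^ 3"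
    using abs_ge_minus_self[of "exp t / 6 * w ^ 3"] by (simp add: abs_mult power_abs)
  moreover have "exp w = 1 + w + w\<^sup>2 / 2 + exp t / 6 * w ^ 3"
    using t(2) by (simp add: numeral_eq_Suc)
  ultimately show ?thesis by linarith
qed

text \<open>For \<open>a * \<bar>x\<bar> \<le> 1\<close> this is the Taylor expansion of
  \<open>exp w\<close>, combined with \<open>exp (- z) \<ge> 1 - z\<close> for the
  \<open>q\<close>-term; for larger increments the left side is already nonpositive. The factor
  \<open>min 1 (a * \<bar>x\<bar>)\<close> makes the error cubic for small increments but only
  quadratic for large ones, so that second moments control it.\<close>

lemma exp_ge_quadratic_minus_truncated:
  fixes a p q x R :: real
  assumes a: "0 < a" and p: "\<bar>p\<bar> \<le> R" and q: "0 \<le> q"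
  shows "1 + a * p * x + (a * p * x)\<^sup>2 / 2 - exp R * q * (a\<^sup>2 * x\<^sup>2)
           - (1 + R + R\<^sup>2 + exp R * R ^ 3) * a\<^sup>2 * (x\<^sup>2 * min 1 (a * \<bar>x\<bar>))
         \<le> exp (a * p * x - q * (a\<^sup>2 * x\<^sup>2))"
proof -
  define v where "v = a * \<bar>x\<bar>"
  define w where "w = a * p * x"
  define K where "K = 1 + R + R\<^sup>2 + exp R * R ^ 3"
  have R: "0 \<le> R" using p by linarith
  have v0: "0 \<le> v" using a by (simp add: v_def)
  have v2: "a\<^sup>2 * x\<^sup>2 = v\<^sup>2" by (simp add: v_def power_mult_distrib)
  have "\<bar>w\<bar> = \<bar>p\<bar> * v" using a by (simp add: w_def v_def abs_mult)
  then have w: "\<bar>w\<bar> \<le> R * v" using p v0 by (simp add: mult_right_mono)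
  have main: "1 + w + w\<^sup>2 / 2 - exp R * q * v\<^sup>2 - K * (v\<^sup>2 * min 1 v) \<le> exp (w - q * v\<^sup>2)"
  proof (cases "v \<le> 1")
    case True
    then have wR: "\<bar>w\<bar> \<le> R" using w R by (meson mult_left_le order_trans)
    have "\<bar>w\<bar> ^ 3 \<le> (R * v) ^ 3" using w by (intro power_mono) auto
    then have "exp R * \<bar>w\<bar> ^ 3 \<le> exp R * (R * v) ^ 3" by (intro mult_left_mono) auto
    also have "\<dots> = (exp R * R ^ 3) * (v\<^sup>2 * v)"
      by (simp add: power_mult_distrib power2_eq_square power3_eq_cube)
    also have "\<dots> \<le> K * (v\<^sup>2 * v)"
      using R v0 by (intro mult_right_mono) (auto simp: K_def)
    finally have 1: "1 + w + w\<^sup>2 / 2 - K * (v\<^sup>2 * v) \<le> exp w"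
      using exp_ge_quadratic_minus_cubic[OF wR] by linarith
    have "exp w * (1 - q * v\<^sup>2) \<le> exp w * exp (- (q * v\<^sup>2))"
      using exp_ge_add_one_self[of "- (q * v\<^sup>2)"] by (intro mult_left_mono) auto
    moreover have "exp w * (q * v\<^sup>2) \<le> exp R * (q * v\<^sup>2)"
      using wR q by (intro mult_right_mono) auto
    ultimately have "exp w - exp R * (q * v\<^sup>2) \<le> exp (w - q * v\<^sup>2)"
      by (simp add: algebra_simps flip: exp_add)
    then show ?thesis using 1 True by (simp add: mult.assoc)
  next
    case False
    then have vv: "1 \<le> v\<^sup>2" "v \<le> v\<^sup>2"
      using one_le_power[of v 2] mult_left_mono[of 1 v v] by (simp_all add: power2_eq_square)
    have "w \<le> R * v\<^sup>2" using w vv(2) R by (meson abs_le_D1 mult_left_mono order_trans)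
    moreover have "w\<^sup>2 \<le> R\<^sup>2 * v\<^sup>2"
      using power_mono[OF w, of 2] by (simp add: power_mult_distrib)
    moreover have "0 \<le> R\<^sup>2 * v\<^sup>2" "0 \<le> exp R * R ^ 3 * v\<^sup>2" "0 \<le> exp R * q * v\<^sup>2"
      using R q by auto
    \<comment> \<open>The summands \<open>1\<close>, \<open>R\<close> and \<open>R\<^sup>2\<close>
      of \<open>K\<close> beat the terms \<open>1\<close>, \<open>w\<close> and
      \<open>w\<^sup>2 / 2\<close>, because \<open>1\<close> and \<open>v\<close> are at most
      \<open>v\<^sup>2\<close> here.\<close>
    ultimately have "1 + w + w\<^sup>2 / 2 - exp R * q * v\<^sup>2 - K * v\<^sup>2 \<le> 0"
      using vv(1) unfolding K_def distrib_right by linarith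
    also have "0 \<le> exp (w - q * v\<^sup>2)" by simp
    finally show ?thesis using False by simp
  qed
  have e: "K * a\<^sup>2 * (x\<^sup>2 * min 1 (a * \<bar>x\<bar>)) = K * (v\<^sup>2 * min 1 v)"
    by (simp add: v_def power_mult_distrib)
  show ?thesis using main unfolding w_def[symmetric] K_def[symmetric] v2 e .
qed

text \<open>Below the threshold \<open>a * \<bar>x\<bar> = sqrt a\<close> the minimum is at most
  \<open>sqrt a\<close>. Above it \<open>x\<^sup>2 \<ge> 1 / a\<close>, so subtracting
  \<open>1 / (2 * a)\<close> removes at most half of \<open>x\<^sup>2\<close>. This turns the Taylor
  error into the truncated squares of the tail condition.\<close>

lemma square_times_min_le:
  fixes a x :: real
  assumes a: "0 < a"
  shows "x\<^sup>2 * min 1 (a * \<bar>x\<bar>) \<le> sqrt a * x\<^sup>2 + 2 * max (x\<^sup>2 - 1 / (2 * a)) 0"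
proof (cases "a * \<bar>x\<bar> \<le> sqrt a")
  case True
  have "x\<^sup>2 * min 1 (a * \<bar>x\<bar>) \<le> x\<^sup>2 * sqrt a"
    using True by (intro mult_left_mono) auto
  then show ?thesis by (smt (verit) mult.commute)
next
  case False
  then have "(sqrt a)\<^sup>2 \<le> (a * \<bar>x\<bar>)\<^sup>2" using a by (intro power_mono) auto
  moreover have "(a * \<bar>x\<bar>)\<^sup>2 = a * (a * x\<^sup>2)"
    by (simp add: power_mult_distrib) (simp add: power2_eq_square)
  ultimately have "a * 1 \<le> a * (a * x\<^sup>2)" using a by simp
  then have "1 \<le> a * x\<^sup>2" using a mult_le_cancel_left_pos by blast
  then have "1 / a \<le> x\<^sup>2" using a by (simp add: field_simps)
  moreover have "x\<^sup>2 * min 1 (a * \<bar>x\<bar>) \<le> x\<^sup>2 * 1" by (intro mult_left_mono) auto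
  moreover have "2 * (x\<^sup>2 - 1 / (2 * a)) = 2 * x\<^sup>2 - 1 / a" by (simp add: field_simps)
  moreover have "0 \<le> sqrt a * x\<^sup>2" using a by simp
  ultimately show ?thesis by linarith
qed

text \<open>Converts the linear gain of one step into an exponential factor, so that steps can be
  multiplied. The slack \<open>\<delta> - \<eta> \<ge> \<delta> / 2\<close> pays for the
  second-order error. Since \<open>exp v * (1 - v) \<le> 1\<close>, it is enough to bound
  \<open>(1 + h * (r - \<eta>)) * (1 - v)\<close> below by 1.\<close>

lemma exp_compare:
  fixes h r \<eta> \<delta> r0 :: real
  assumes h: "0 \<le> h" and r: "0 \<le> r" "r \<le> r0" and \<eta>: "0 \<le> \<eta>" "\<eta> \<le> \<delta> / 2" and \<delta>: "0 < \<delta>"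
    and small: "h * (r0 + \<delta>)\<^sup>2 \<le> \<delta> / 2" "h * (r0 + \<delta>) < 1"
  shows "exp (h * (r - \<delta>)) \<le> 1 + h * (r - \<eta>)"
proof -
  define v where "v = h * (r - \<delta>)"
  have "(r - \<eta>) * (r - \<delta>) \<le> \<bar>r - \<eta>\<bar> * \<bar>r - \<delta>\<bar>" by (metis abs_ge_self abs_mult)
  also have "\<dots> \<le> (r0 + \<delta>) * (r0 + \<delta>)" using r \<eta> \<delta> by (intro mult_mono) auto
  finally have "h * ((r - \<eta>) * (r - \<delta>)) \<le> h * (r0 + \<delta>)\<^sup>2"
    using h by (simp add: power2_eq_square mult_left_mono)
  \<comment> \<open>The left side is exactly
    \<open>(1 + h * (r - \<eta>)) * (1 - v) - 1\<close>.\<close>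
  then have "h * ((\<delta> - \<eta>) - h * ((r - \<eta>) * (r - \<delta>))) \<ge> 0"
    using small(1) \<eta> h by (intro mult_nonneg_nonneg) auto
  then have "1 \<le> (1 + h * (r - \<eta>)) * (1 - v)"
    by (simp add: v_def algebra_simps)
  moreover have "v < 1"
    using mult_left_mono[of "r - \<delta>" "r0 + \<delta>" h] h r \<delta> small(2) unfolding v_def by linarith
  moreover have "exp v * (1 - v) \<le> 1"
    using mult_left_mono[OF exp_ge_add_one_self[of "- v"], of "exp v"] by (simp flip: exp_add)
  ultimately have "exp v * (1 - v) \<le> (1 + h * (r - \<eta>)) * (1 - v)" "0 < 1 - v" by linarith+
  then show ?thesis unfolding v_def[symmetric] using mult_le_cancel_right_pos by blast
qed

section \<open>Admissible test functions\<close>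

lemma lipschitz_sum_in_C_lLip:
  fixes g :: "real \<Rightarrow> real"
  assumes "L-lipschitz_on UNIV g"
  shows "(\<lambda>v. g (\<Sum>i<n. v i)) \<in> C_lLip n"
proof -
  have L: "0 \<le> L" using assms lipschitz_on_nonneg by blast
  \<comment> \<open>Growth exponent 0 suffices and turns the middle factor into 3; the added 1 keeps
    the constant positive when \<open>L * n = 0\<close>.\<close>
  have "\<bar>g (\<Sum>i<n. x i) - g (\<Sum>i<n. y i)\<bar> \<le>
      (L * n + 1) * (1 + L2_set x {..<n} ^ 0 + L2_set y {..<n} ^ 0) * L2_set (\<lambda>i. x i - y i) {..<n}"
    for x y
  proof -
    define d where "d = L2_set (\<lambda>i. x i - y i) {..<n}"
    have d: "0 \<le> d" by (simp add: d_def)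
    have "\<bar>x i - y i\<bar> \<le> d" if "i < n" for i
      using member_le_L2_set[of "{..<n}" i "\<lambda>i. \<bar>x i - y i\<bar>"] that unfolding d_def L2_set_def by simp
    then have "(\<Sum>i<n. \<bar>x i - y i\<bar>) \<le> (\<Sum>i<n. d)" by (intro sum_mono) auto
    then have "\<bar>(\<Sum>i<n. x i) - (\<Sum>i<n. y i)\<bar> \<le> n * d"
      using sum_abs[of "\<lambda>i. x i - y i" "{..<n}"] by (simp add: sum_subtractf)
    then have "L * \<bar>(\<Sum>i<n. x i) - (\<Sum>i<n. y i)\<bar> \<le> L * (n * d)"
      using L by (rule mult_left_mono)
    then have "\<bar>g (\<Sum>i<n. x i) - g (\<Sum>i<n. y i)\<bar> \<le> L * (n * d)"
      using lipschitz_onD[OF assms, of "\<Sum>i<n. x i" "\<Sum>i<n. y i"] by (simp add: dist_real_def)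
    also have "\<dots> \<le> (L * n + 1) * 3 * d" using L d by (simp add: algebra_simps)
    finally show ?thesis by (simp add: d_def)
  qed
  moreover have "0 < L * n + 1" using L by (simp add: add_nonneg_pos)
  ultimately show ?thesis unfolding C_lLip_def by blast
qed

lemma truncated_square_in_C_lLip: "(\<lambda>v. max ((v 0)\<^sup>2 - c) d) \<in> C_lLip 1"
proof -
  have "\<bar>max ((x 0)\<^sup>2 - c) d - max ((y 0)\<^sup>2 - c) d\<bar> \<le>
      1 * (1 + L2_set x {..<1} ^ 1 + L2_set y {..<1} ^ 1) * L2_set (\<lambda>i. x i - y i) {..<1}"
    for x y :: "nat \<Rightarrow> real"
  proof -
    have "\<bar>max ((x 0)\<^sup>2 - c) d - max ((y 0)\<^sup>2 - c) d\<bar> \<le> \<bar>(x 0)\<^sup>2 - (y 0)\<^sup>2\<bar>" by linarith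
    also have "\<dots> = \<bar>x 0 + y 0\<bar> * \<bar>x 0 - y 0\<bar>"
      by (simp add: abs_mult[symmetric] power2_eq_square algebra_simps)
    also have "\<dots> \<le> (1 + \<bar>x 0\<bar> + \<bar>y 0\<bar>) * \<bar>x 0 - y 0\<bar>" by (intro mult_right_mono) auto
    finally show ?thesis by (simp add: L2_set_def lessThan_Suc)
  qed
  then show ?thesis unfolding C_lLip_def using zero_less_one by blast
qed

section \<open>The transition operator and closure properties of \<open>H\<close>\<close>

text \<open>Real-valued, so that it can be iterated. For bounded Lipschitz \<open>g\<close> and
  \<open>Z\<close> in \<open>H\<close> the coercion loses nothing, by
  \<open>transition_eq\<close>.\<close>

definition transition ::
  "(('a \<Rightarrow> real) \<Rightarrow> ereal) \<Rightarrow> ('a \<Rightarrow> real) \<Rightarrow> (real \<Rightarrow> real) \<Rightarrow> real \<Rightarrow> real" where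
  "transition F Z g s = real_of_ereal (F (\<lambda>\<omega>. g (s + Z \<omega>)))"

context sublinear_expectation_space
begin

text \<open>Constants are the functions of the empty vector, so composition with
  \<open>n = 0\<close> yields them.\<close>

lemma H_const: "(\<lambda>_. c) \<in> H"
proof -
  have "(\<lambda>_. c) \<in> C_lLip 0" unfolding C_lLip_def by (auto simp: L2_set_def intro: exI[of _ 1])
  from H_compose[OF _ this] show ?thesis by simp
qed

lemma H_uminus: "X \<in> H \<Longrightarrow> (\<lambda>\<omega>. - X \<omega>) \<in> H"
  using H_scale[of X "-1"] by simp

lemma H_diff: "X \<in> H \<Longrightarrow> Y \<in> H \<Longrightarrow> (\<lambda>\<omega>. X \<omega> - Y \<omega>) \<in> H"
  using H_add[of X "\<lambda>\<omega>. - Y \<omega>"] H_uminus by simp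

lemma H_sum: "(\<And>i. i \<in> I \<Longrightarrow> X i \<in> H) \<Longrightarrow> (\<lambda>\<omega>. \<Sum>i\<in>I. X i \<omega>) \<in> H"
  by (induction I rule: infinite_finite_induct) (auto intro: H_zero H_add)

lemma H_lipschitz: "L-lipschitz_on UNIV g \<Longrightarrow> X \<in> H \<Longrightarrow> (\<lambda>\<omega>. g (X \<omega>)) \<in> H"
  using H_compose[of 1 "\<lambda>_. X", OF _ lipschitz_sum_in_C_lLip] by simp

lemma H_lipschitz_shift:
  "L-lipschitz_on UNIV g \<Longrightarrow> X \<in> H \<Longrightarrow> (\<lambda>\<omega>. g (s + X \<omega>)) \<in> H"
  by (intro H_lipschitz[of L g "\<lambda>\<omega>. s + X \<omega>"] H_add H_const)

lemma H_truncated_square: "X \<in> H \<Longrightarrow> (\<lambda>\<omega>. max ((X \<omega>)\<^sup>2 - c) d) \<in> H"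
  using H_compose[of 1 "\<lambda>_. X", OF _ truncated_square_in_C_lLip] by simp

lemma H_square: "X \<in> H \<Longrightarrow> (\<lambda>\<omega>. (X \<omega>)\<^sup>2) \<in> H"
  using H_truncated_square[of X 0 0] by (simp add: max_absorb1)

section \<open>Estimates for \<open>E\<close> and its conjugate\<close>

lemma E_add_finite:
  assumes "X \<in> H" "Y \<in> H" "E Y = ereal c"
  shows "E (\<lambda>\<omega>. X \<omega> + Y \<omega>) \<le> E X + ereal c"
  using E_subadd[OF assms(1,2)] assms(3) by simp

lemma E_bounded:
  assumes "Y \<in> H" "\<And>\<omega>. \<bar>Y \<omega>\<bar> \<le> B"
  shows "\<bar>E Y\<bar> \<noteq> \<infinity>" "\<bar>real_of_ereal (E Y)\<bar> \<le> B"
proof -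
  have "E (\<lambda>_. - B) \<le> E Y" "E Y \<le> E (\<lambda>_. B)"
    using assms(2) by (intro E_mono assms(1) H_const; smt (verit))+
  then have "ereal (- B) \<le> E Y" "E Y \<le> ereal B" by (simp_all add: E_const)
  then show "\<bar>E Y\<bar> \<noteq> \<infinity>" "\<bar>real_of_ereal (E Y)\<bar> \<le> B" by (cases "E Y"; auto)+
qed

lemma E_bounded_diff:
  assumes Y: "Y \<in> H" "\<And>\<omega>. \<bar>Y \<omega>\<bar> \<le> B" and Z: "Z \<in> H" "\<And>\<omega>. \<bar>Z \<omega>\<bar> \<le> B"
    and d: "\<And>\<omega>. Y \<omega> - Z \<omega> \<le> d"
  shows "real_of_ereal (E Y) - real_of_ereal (E Z) \<le> d"
proof -
  have "E Y \<le> E (\<lambda>\<omega>. Z \<omega> + d)"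
    by (intro E_mono H_add Y Z H_const) (use d in \<open>simp add: diff_le_eq add.commute\<close>)
  also have "\<dots> \<le> E Z + ereal d"
    by (intro E_add_finite Z H_const E_const)
  finally show ?thesis
    using E_bounded[OF Y] E_bounded[OF Z] by (cases "E Y"; cases "E Z") auto
qed

lemma functional_mono:
  assumes "F \<in> {E, conjugate_expectation E}" "X \<in> H" "Y \<in> H" "\<And>\<omega>. Y \<omega> \<le> X \<omega>"
  shows "F Y \<le> F X"
  using assms by (auto simp: conjugate_expectation_def intro!: E_mono H_uminus)

lemma functional_const:
  assumes "F \<in> {E, conjugate_expectation E}"
  shows "F (\<lambda>_. c) = ereal c"
  using assms by (auto simp: conjugate_expectation_def E_const)

lemma functional_bounded:
  assumes F: "F \<in> {E, conjugate_expectation E}" and Y: "Y \<in> H" "\<And>\<omega>. \<bar>Y \<omega>\<bar> \<le> B"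
  shows "F Y = ereal (real_of_ereal (F Y))" "\<bar>real_of_ereal (F Y)\<bar> \<le> B"
proof -
  note E_bounded[OF Y] E_bounded[OF H_uminus[OF Y(1)], of B]
  then show "F Y = ereal (real_of_ereal (F Y))" "\<bar>real_of_ereal (F Y)\<bar> \<le> B"
    using F Y(2) by (auto simp: conjugate_expectation_def ereal_real)
qed

text \<open>Both functionals are nonexpansive in the supremum norm; this is what carries Lipschitz
  constants through \<open>transition\<close>.\<close>

lemma functional_bounded_diff:
  assumes F: "F \<in> {E, conjugate_expectation E}"
    and Y: "Y \<in> H" "\<And>\<omega>. \<bar>Y \<omega>\<bar> \<le> B" and Z: "Z \<in> H" "\<And>\<omega>. \<bar>Z \<omega>\<bar> \<le> B"
    and d: "\<And>\<omega>. \<bar>Y \<omega> - Z \<omega>\<bar> \<le> d"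
  shows "\<bar>real_of_ereal (F Y) - real_of_ereal (F Z)\<bar> \<le> d"
proof -
  have d': "Y \<omega> - Z \<omega> \<le> d" "Z \<omega> - Y \<omega> \<le> d" "- Y \<omega> - - Z \<omega> \<le> d" "- Z \<omega> - - Y \<omega> \<le> d" for \<omega>
    using d[of \<omega>] by linarith+
  have m: "\<bar>- Y \<omega>\<bar> \<le> B" "\<bar>- Z \<omega>\<bar> \<le> B" for \<omega> using Y(2) Z(2) by simp_all
  note E_bounded_diff[OF Y Z d'(1)] E_bounded_diff[OF Z Y d'(2)]
    E_bounded_diff[OF H_uminus[OF Y(1)] m(1) H_uminus[OF Z(1)] m(2) d'(3)]
    E_bounded_diff[OF H_uminus[OF Z(1)] m(2) H_uminus[OF Y(1)] m(1) d'(4)]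
  then show ?thesis using F by (auto simp: conjugate_expectation_def)
qed

text \<open>Sub-additivity is used in rearranged form: the convex term
  \<open>k2 * (Z \<omega>)\<^sup>2\<close> is recovered from the whole expression by adding back the
  other terms. Thus \<open>F\<close> itself sees only the convex term, the error terms cost their
  upper expectations, and the linear term costs nothing.\<close>

lemma functional_quadratic_ge:
  assumes F: "F \<in> {E, conjugate_expectation E}"
    and Z: "Z \<in> H" and mean: "E Z = 0" "E (\<lambda>\<omega>. - Z \<omega>) = 0"
    and V: "E (\<lambda>\<omega>. (Z \<omega>)\<^sup>2) = ereal V" and s: "F (\<lambda>\<omega>. (Z \<omega>)\<^sup>2) = ereal s"
    and W: "W \<in> H" "E W = ereal \<theta>"
    and nonneg: "0 \<le> k2" "0 \<le> e1" "0 \<le> e2"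
  shows "ereal (k0 + k2 * s - e1 * V - e2 * \<theta>)
    \<le> F (\<lambda>\<omega>. k0 + k1 * Z \<omega> + k2 * (Z \<omega>)\<^sup>2 - e1 * (Z \<omega>)\<^sup>2 - e2 * W \<omega>)"
proof -
  let ?Q = "\<lambda>\<omega>. k0 + k1 * Z \<omega> + k2 * (Z \<omega>)\<^sup>2 - e1 * (Z \<omega>)\<^sup>2 - e2 * W \<omega>"
  \<comment> \<open>Homogeneity covers only nonnegative factors, so each sign of \<open>k1\<close>
    uses its own half of the mean-zero assumption.\<close>
  have EZ: "E (\<lambda>\<omega>. - k1 * Z \<omega>) = ereal 0"
  proof (cases "k1 \<le> 0")
    case True
    then show ?thesis using E_pos_homog[OF Z, of "- k1"] mean by simp
  next
    case False
    then show ?thesis using E_pos_homog[OF H_uminus[OF Z], of k1] mean by simp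
  qed
  have E1: "E (\<lambda>\<omega>. e1 * (Z \<omega>)\<^sup>2) = ereal (e1 * V)"
    using E_pos_homog[OF H_square[OF Z] nonneg(2)] V by simp
  have E2: "E (\<lambda>\<omega>. e2 * W \<omega>) = ereal (e2 * \<theta>)"
    using E_pos_homog[OF W(1) nonneg(3)] W(2) by simp
  \<comment> \<open>Used with \<open>U = ?Q\<close> when \<open>F\<close> is \<open>E\<close>, and
    with \<open>U\<close> the negated convex term when \<open>F\<close> is the conjugate.\<close>
  have add: "E (\<lambda>\<omega>. U \<omega> + e1 * (Z \<omega>)\<^sup>2 + e2 * W \<omega> + - k0 + - k1 * Z \<omega>)
      \<le> E U + ereal (e1 * V) + ereal (e2 * \<theta>) + ereal (- k0) + ereal 0" if "U \<in> H" for U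
  proof -
    note mem = H_add H_scale H_square Z W(1) that H_const
    have a1: "E (\<lambda>\<omega>. U \<omega> + e1 * (Z \<omega>)\<^sup>2) \<le> E U + ereal (e1 * V)"
      by (intro E_add_finite E1 mem)
    have a2: "E (\<lambda>\<omega>. U \<omega> + e1 * (Z \<omega>)\<^sup>2 + e2 * W \<omega>)
        \<le> E (\<lambda>\<omega>. U \<omega> + e1 * (Z \<omega>)\<^sup>2) + ereal (e2 * \<theta>)"
      by (intro E_add_finite E2 mem)
    have a3: "E (\<lambda>\<omega>. U \<omega> + e1 * (Z \<omega>)\<^sup>2 + e2 * W \<omega> + - k0)
        \<le> E (\<lambda>\<omega>. U \<omega> + e1 * (Z \<omega>)\<^sup>2 + e2 * W \<omega>) + ereal (- k0)"
      by (intro E_add_finite E_const mem)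
    have a4: "E (\<lambda>\<omega>. U \<omega> + e1 * (Z \<omega>)\<^sup>2 + e2 * W \<omega> + - k0 + - k1 * Z \<omega>)
        \<le> E (\<lambda>\<omega>. U \<omega> + e1 * (Z \<omega>)\<^sup>2 + e2 * W \<omega> + - k0) + ereal 0"
      by (intro E_add_finite EZ mem)
    show ?thesis
      by (intro order_trans[OF a4] add_right_mono order_trans[OF a3] order_trans[OF a2] a1)
  qed
  have Q: "?Q \<in> H" by (intro H_add H_diff H_scale H_square Z W H_const)
  from F consider "F = E" | "F = conjugate_expectation E" by blast
  then show ?thesis
  proof cases
    case 1
    have "ereal (k2 * s) = E (\<lambda>\<omega>. k2 * (Z \<omega>)\<^sup>2)"
      using E_pos_homog[OF H_square[OF Z] nonneg(1)] s 1 by simp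
    also have "\<dots> = E (\<lambda>\<omega>. ?Q \<omega> + e1 * (Z \<omega>)\<^sup>2 + e2 * W \<omega> + - k0 + - k1 * Z \<omega>)" by simp
    also note add[OF Q]
    finally show ?thesis unfolding 1 by (cases "E ?Q") auto
  next
    case 2
    have eq: "E (\<lambda>\<omega>. k2 * (- (Z \<omega>)\<^sup>2)) = ereal (- k2 * s)"
    proof -
      have "E (\<lambda>\<omega>. - (Z \<omega>)\<^sup>2) = ereal (- s)"
        using s unfolding 2 conjugate_expectation_def by (cases "E (\<lambda>\<omega>. - (Z \<omega>)\<^sup>2)") auto
      then show ?thesis using E_pos_homog[OF H_uminus[OF H_square[OF Z]] nonneg(1)] by simp
    qed
    have "E (\<lambda>\<omega>. - ?Q \<omega>) =
        E (\<lambda>\<omega>. k2 * (- (Z \<omega>)\<^sup>2) + e1 * (Z \<omega>)\<^sup>2 + e2 * W \<omega> + - k0 + - k1 * Z \<omega>)"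
      by (rule arg_cong[of _ _ E]) auto
    also note add[OF H_scale[OF H_uminus[OF H_square[OF Z]]], of k2]
    finally show ?thesis unfolding 2 conjugate_expectation_def eq
      by (cases "E (\<lambda>\<omega>. - ?Q \<omega>)") auto
  qed
qed

section \<open>Iterates of the transition operator\<close>

lemma transition_eq:
  assumes "F \<in> {E, conjugate_expectation E}" "Z \<in> H" "L-lipschitz_on UNIV g" "\<And>x. \<bar>g x\<bar> \<le> B"
  shows "F (\<lambda>\<omega>. g (s + Z \<omega>)) = ereal (transition F Z g s)"
  unfolding transition_def using assms by (intro functional_bounded H_lipschitz_shift) auto

lemma transition_bounded:
  assumes "F \<in> {E, conjugate_expectation E}" "Z \<in> H" "L-lipschitz_on UNIV g" "\<And>x. \<bar>g x\<bar> \<le> B"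
  shows "\<bar>transition F Z g s\<bar> \<le> B"
  unfolding transition_def using assms by (intro functional_bounded H_lipschitz_shift) auto

lemma transition_lipschitz:
  assumes F: "F \<in> {E, conjugate_expectation E}" and Z: "Z \<in> H"
    and g: "L-lipschitz_on UNIV g" "\<And>x. \<bar>g x\<bar> \<le> B"
  shows "L-lipschitz_on UNIV (transition F Z g)"
proof (rule lipschitz_onI)
  fix s t :: real
  show "dist (transition F Z g s) (transition F Z g t) \<le> L * dist s t"
    unfolding transition_def dist_real_def
  proof (rule functional_bounded_diff[OF F _ g(2) _ g(2)])
    show "\<bar>g (s + Z \<omega>) - g (t + Z \<omega>)\<bar> \<le> L * \<bar>s - t\<bar>" for \<omega>
      using lipschitz_onD[OF g(1), of "s + Z \<omega>" "t + Z \<omega>"] by (simp add: dist_real_def)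
  qed (intro H_lipschitz_shift[OF g(1)] Z)+
qed (use g(1) lipschitz_on_nonneg in blast)

text \<open>Neither the Lipschitz constant nor the bound deteriorates, so every iterate is again an
  admissible test function.\<close>

lemma transition_funpow:
  assumes "F \<in> {E, conjugate_expectation E}" "Z \<in> H" "L-lipschitz_on UNIV g" "\<And>x. \<bar>g x\<bar> \<le> B"
  shows "L-lipschitz_on UNIV ((transition F Z ^^ j) g) \<and> (\<forall>x. \<bar>(transition F Z ^^ j) g x\<bar> \<le> B)"
  by (induction j) (use assms in \<open>auto intro: transition_lipschitz transition_bounded\<close>)

text \<open>The minorant \<open>W\<close> only has to lie in \<open>H\<close>. It may be an
  unbounded quadratic in \<open>Z\<close>, which is why its expectation is bounded in the extended
  reals.\<close>

lemma transition_mono: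
  assumes F: "F \<in> {E, conjugate_expectation E}" and Z: "Z \<in> H"
    and g: "L-lipschitz_on UNIV g" "\<And>x. \<bar>g x\<bar> \<le> B"
    and W: "W \<in> H" "ereal c \<le> F W" "\<And>\<omega>. W \<omega> \<le> g (s + Z \<omega>)"
  shows "c \<le> transition F Z g s"
proof -
  note W(2)
  also have "F W \<le> F (\<lambda>\<omega>. g (s + Z \<omega>))"
    by (intro functional_mono F W H_lipschitz_shift[OF g(1)] Z)
  finally show ?thesis using transition_eq[OF F Z g] by simp
qed

lemma transition_conjugate:
  "transition (conjugate_expectation E) Z g = (\<lambda>s. - transition E Z (\<lambda>x. - g x) s)"
  by (simp add: transition_def conjugate_expectation_def fun_eq_iff)

text \<open>The minus signs between consecutive steps cancel. This reduces the conjugate to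
  \<open>E\<close>, for which independence is formulated.\<close>

lemma transition_conjugate_funpow:
  "(transition (conjugate_expectation E) Z ^^ n) g = (\<lambda>s. - (transition E Z ^^ n) (\<lambda>x. - g x) s)"
  by (induction n) (simp_all add: transition_conjugate)

section \<open>Expectations of functions of the partial sums\<close>

lemma iid_transition:
  assumes iid: "iid_sequence H E X" and i: "1 \<le> i"
    and g: "L-lipschitz_on UNIV g" "\<And>x. \<bar>g x\<bar> \<le> B"
  shows "E (\<lambda>\<omega>. g (s + X i \<omega>)) = ereal (transition E (X 1) g s)"
proof -
  have X: "X i \<in> H" "X 1 \<in> H" and id: "identically_distributed E (X i) (X 1)"
    using iid i by (auto simp: iid_sequence_def)
  have "L-lipschitz_on UNIV (\<lambda>x. g (s + x))"
    using g(1) by (auto simp: lipschitz_on_def dist_real_def) (metis add_diff_cancel_left)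
  from lipschitz_sum_in_C_lLip[OF this, of 1] have "(\<lambda>v. g (s + v 0)) \<in> C_lLip 1" by simp
  moreover have "\<bar>E (\<lambda>\<omega>. g (s + X i \<omega>))\<bar> \<noteq> \<infinity>" "\<bar>E (\<lambda>\<omega>. g (s + X 1 \<omega>))\<bar> \<noteq> \<infinity>"
    by (rule E_bounded(1)[OF H_lipschitz_shift[OF g(1)] g(2)], rule X)+
  ultimately have "E (\<lambda>\<omega>. g (s + X i \<omega>)) = E (\<lambda>\<omega>. g (s + X 1 \<omega>))"
    by (rule id[unfolded identically_distributed_def, rule_format])
  then show ?thesis using transition_eq[of E "X 1", OF _ X(2) g] by simp
qed

text \<open>Independence is applied to \<open>g\<close> of the sum of all coordinates. Its side
  conditions hold because the inner expectations are Lipschitz functions of the partial sum: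
  \<open>T g\<close> for \<open>\<phi>hat\<close> and \<open>T h\<close> with
  \<open>h = \<bar>g\<bar>\<close> for \<open>\<phi>bar\<close>.\<close>

lemma indep_transition:
  assumes iid: "iid_sequence H E X" and i: "1 \<le> i"
    and g: "L-lipschitz_on UNIV g" "\<And>x. \<bar>g x\<bar> \<le> B"
  shows "E (\<lambda>\<omega>. g (\<Sum>k=1..Suc i. X k \<omega>)) = E (\<lambda>\<omega>. transition E (X 1) g (\<Sum>k=1..i. X k \<omega>))"
proof -
  have X: "X k \<in> H" if "1 \<le> k" for k using iid that by (auto simp: iid_sequence_def)
  have ind: "indep_to H E 1 (\<lambda>_. X (Suc i)) i (\<lambda>j. X (Suc j))"
    using iid i by (auto simp: iid_sequence_def)
  define h where "h x = \<bar>g x\<bar>" for x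
  have h: "L-lipschitz_on UNIV h" "\<And>x. \<bar>h x\<bar> \<le> B"
    using g by (auto simp: h_def lipschitz_on_def dist_real_def) (smt (verit))
  define T where "T = transition E (X 1)"
  have Tg: "L-lipschitz_on UNIV (T g)" and Th: "L-lipschitz_on UNIV (T h)" "\<And>s. \<bar>T h s\<bar> \<le> B"
    using transition_lipschitz[of E "X 1", OF _ _ g] transition_lipschitz[of E "X 1", OF _ _ h]
      transition_bounded[of E "X 1", OF _ _ h] X[of 1] by (auto simp: T_def)
  \<comment> \<open>Allows the absolute value in \<open>barX\<close> to be dropped.\<close>
  have T0: "0 \<le> T h s" for s
    unfolding T_def using X[of 1]
    by (intro transition_mono[OF _ _ h H_zero]) (auto simp: E_const h_def)
  define f where "f v = g (\<Sum>j<i+1. v j)" for v :: "nat \<Rightarrow> real"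
  have f: "f \<in> C_lLip (i + 1)" unfolding f_def by (rule lipschitz_sum_in_C_lLip[OF g(1)])
  have sum: "(\<Sum>j<i+1. vec_append i x z j) = (\<Sum>j<i. x j) + z 0" for x z :: "nat \<Rightarrow> real"
    by (simp add: vec_append_def)
  have S: "(\<lambda>\<omega>. \<Sum>j<i. X (Suc j) \<omega>) \<in> H" by (intro H_sum X) auto
  have e1: "E (\<lambda>\<omega>. f (vec_append i x (\<lambda>j. X (Suc i) \<omega>))) = ereal (T g (\<Sum>j<i. x j))" for x
    using iid_transition[OF iid _ g, of "Suc i"] by (simp only: f_def sum T_def)
  have e2: "E (\<lambda>\<omega>. \<bar>f (vec_append i x (\<lambda>j. X (Suc i) \<omega>))\<bar>) = ereal (T h (\<Sum>j<i. x j))" for x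
  proof -
    have "\<bar>f v\<bar> = h (\<Sum>j<i+1. v j)" for v by (simp add: f_def h_def)
    then show ?thesis using iid_transition[OF iid _ h, of "Suc i"] by (simp only: sum T_def)
  qed
  have m1: "(\<lambda>\<omega>. T g (\<Sum>j<i. X (Suc j) \<omega>)) \<in> H" by (rule H_lipschitz[OF Tg S])
  have m2: "(\<lambda>\<omega>. T h (\<Sum>j<i. X (Suc j) \<omega>)) \<in> H" by (rule H_lipschitz[OF Th(1) S])
  have fin: "E (\<lambda>\<omega>. T h (\<Sum>j<i. X (Suc j) \<omega>)) < \<infinity>"
    using E_bounded(1)[OF m2 Th(2)] by auto
  have "E (\<lambda>\<omega>. f (vec_append i (\<lambda>j. X (Suc j) \<omega>) (\<lambda>j. X (Suc i) \<omega>)))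
      = E (\<lambda>\<omega>. T g (\<Sum>j<i. X (Suc j) \<omega>))"
    using ind[unfolded indep_to_def Let_def, THEN conjunct2, THEN conjunct2, rule_format, OF f]
      m1 m2 fin T0 unfolding e1 e2 by simp
  moreover have "(\<Sum>j<i. X (Suc j) \<omega>) = (\<Sum>k=1..i. X k \<omega>)" for \<omega>
    by (simp add: sum.atLeast1_atMost_eq)
  moreover have "(\<Sum>k=1..Suc i. X k \<omega>) = (\<Sum>k=1..i. X k \<omega>) + X (Suc i) \<omega>" for \<omega> by simp
  ultimately show ?thesis by (simp only: f_def sum T_def)
qed

text \<open>Conditioning on all but the last variable replaces \<open>g\<close> by its transition;
  hence the induction is over all \<open>g\<close>.\<close>

lemma E_iid_sum:
  assumes iid: "iid_sequence H E X"
    and g: "L-lipschitz_on UNIV g" "\<And>x. \<bar>g x\<bar> \<le> B"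
  shows "E (\<lambda>\<omega>. g (\<Sum>k=1..n. X k \<omega>)) = ereal ((transition E (X 1) ^^ n) g 0)"
  using g
proof (induction n arbitrary: g)
  case 0
  then show ?case by (simp add: E_const)
next
  case (Suc n)
  have X: "X 1 \<in> H" using iid by (auto simp: iid_sequence_def)
  show ?case
  \<comment> \<open>Independence is available only from a nonempty initial vector, so the first
    variable is treated by identical distribution alone.\<close>
  proof (cases "n = 0")
    case True
    then show ?thesis using iid_transition[OF iid _ Suc.prems, of 1 0] by simp
  next
    case False
    have "E (\<lambda>\<omega>. g (\<Sum>k=1..Suc n. X k \<omega>)) = E (\<lambda>\<omega>. transition E (X 1) g (\<Sum>k=1..n. X k \<omega>))"
      using False by (intro indep_transition[OF iid _ Suc.prems]) simp
    also have "\<dots> = ereal ((transition E (X 1) ^^ n) (transition E (X 1) g) 0)"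
      using X Suc.prems by (intro Suc.IH transition_lipschitz transition_bounded) auto
    finally show ?thesis by (simp add: funpow_swap1)
  qed
qed

lemma functional_iid_sum:
  assumes F: "F \<in> {E, conjugate_expectation E}" and iid: "iid_sequence H E X"
    and g: "L-lipschitz_on UNIV g" "\<And>x. \<bar>g x\<bar> \<le> B"
  shows "F (\<lambda>\<omega>. g (\<Sum>k=1..n. X k \<omega>)) = ereal ((transition F (X 1) ^^ n) g 0)"
proof -
  have "L-lipschitz_on UNIV (\<lambda>x. - g x)" "\<And>x. \<bar>- g x\<bar> \<le> B"
    using g by (auto simp: lipschitz_on_minus)
  from E_iid_sum[OF iid this, of n] E_iid_sum[OF iid g, of n] F
  show ?thesis by (auto simp: conjugate_expectation_def transition_conjugate_funpow)
qed

section \<open>The Gaussian subsolution\<close>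

text \<open>One step lengthens the time parameter from \<open>T\<close> to
  \<open>T + a\<^sup>2 / y\<^sup>2\<close>. The minorant \<open>W\<close> is the second-order
  expansion of the kernel at \<open>\<xi>\<close> with its error terms; the gain of its expectation
  matches the growth of the kernel up to \<open>a\<^sup>2 * \<eta>\<close>, which the factor
  \<open>exp (- \<delta> * a\<^sup>2)\<close> absorbs. \<open>l\<close> is the factor accumulated in
  earlier steps and \<open>c\<close> the constant subtracted from the kernel.\<close>

lemma functional_gaussian_step:
  fixes a y \<tau> T \<xi> \<rho> \<sigma> \<delta> V \<theta> R K \<eta> :: real
  defines "R \<equiv> \<rho> / (\<sigma>\<^sup>2 * \<tau>)"
  defines "K \<equiv> 1 + R + R\<^sup>2 + exp R * R ^ 3"
  defines "\<eta> \<equiv> (exp R * (1 / (2 * \<sigma>\<^sup>2 * \<tau> * y\<^sup>2)) + K * sqrt a) * V + 2 * K * \<theta>"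
  assumes F: "F \<in> {E, conjugate_expectation E}"
    and Z: "Z \<in> H" and mean: "E Z = 0" "E (\<lambda>\<omega>. - Z \<omega>) = 0"
    and V: "E (\<lambda>\<omega>. (Z \<omega>)\<^sup>2) = ereal V" and s: "F (\<lambda>\<omega>. (Z \<omega>)\<^sup>2) = ereal (\<sigma>\<^sup>2)"
    and \<theta>: "E (\<lambda>\<omega>. max ((Z \<omega>)\<^sup>2 - 1 / (2 * a)) 0) = ereal \<theta>"
    and pos: "0 < \<sigma>" "0 < a" "0 < y" "0 < \<tau>" "\<tau> \<le> T" "0 < \<delta>" "0 \<le> l" and nn: "0 \<le> V" "0 \<le> \<theta>"
    and \<xi>: "\<bar>\<xi>\<bar> \<le> \<rho>"
    and \<eta>: "\<eta> \<le> \<delta> / 2"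
    and small: "a\<^sup>2 * (R\<^sup>2 * \<sigma>\<^sup>2 / 2 + \<delta>)\<^sup>2 \<le> \<delta> / 2" "a\<^sup>2 * (R\<^sup>2 * \<sigma>\<^sup>2 / 2 + \<delta>) < 1"
  shows "\<exists>W\<in>H. ereal (l * exp (- \<delta> * a\<^sup>2) * exp (- (y\<^sup>2 * \<xi>\<^sup>2 / (2 * \<sigma>\<^sup>2 * (T + a\<^sup>2 / y\<^sup>2)))) - c) \<le> F W
    \<and> (\<forall>\<omega>. W \<omega> \<le> l * exp (- (y\<^sup>2 * (\<xi> + a * Z \<omega> / y\<^sup>2)\<^sup>2 / (2 * \<sigma>\<^sup>2 * T))) - c)"
proof -
  \<comment> \<open>In the exponent of the kernel, \<open>p\<close> is the slope and
    \<open>q\<close> the concave part, both with respect to the increment \<open>a * Z\<close>;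
    \<open>q0\<close> bounds \<open>q\<close> uniformly in \<open>T \<ge> \<tau>\<close>.\<close>
  define p where "p = - \<xi> / (\<sigma>\<^sup>2 * T)"
  define q where "q = 1 / (2 * \<sigma>\<^sup>2 * T * y\<^sup>2)"
  define q0 where "q0 = 1 / (2 * \<sigma>\<^sup>2 * \<tau> * y\<^sup>2)"
  define G where "G = exp (- (y\<^sup>2 * \<xi>\<^sup>2 / (2 * \<sigma>\<^sup>2 * T)))"
  define D where "D \<omega> = max ((Z \<omega>)\<^sup>2 - 1 / (2 * a)) 0" for \<omega>
  define e1 where "e1 = l * G * a\<^sup>2 * (exp R * q0 + K * sqrt a)"
  define e2 where "e2 = l * G * a\<^sup>2 * (2 * K)"
  define r where "r = \<sigma>\<^sup>2 * p\<^sup>2 / 2"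
  define W where "W \<omega> = (l * G - c) + (l * G * a * p) * Z \<omega> + (l * G * a\<^sup>2 * p\<^sup>2 / 2) * (Z \<omega>)\<^sup>2
    - e1 * (Z \<omega>)\<^sup>2 - e2 * D \<omega>" for \<omega>
  have T: "0 < T" and \<sigma>2: "0 < \<sigma>\<^sup>2" and \<rho>: "0 \<le> \<rho>" using pos \<xi> by auto
  have R: "0 \<le> R" using \<rho> pos by (simp add: R_def)
  have p: "\<bar>p\<bar> \<le> R" unfolding p_def R_def abs_divide
    using \<xi> \<rho> pos T \<sigma>2 by (intro frac_le) (auto simp: mult_left_mono abs_mult)
  have K: "0 \<le> K" using R by (simp add: K_def)
  have q: "0 \<le> q" "q \<le> q0" unfolding q_def q0_def
    using pos T \<sigma>2 by (auto intro!: divide_left_mono mult_right_mono mult_left_mono)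
  have q0: "0 \<le> q0" using q by linarith
  have G: "0 < G" by (simp add: G_def)
  have D: "D \<in> H" unfolding D_def by (rule H_truncated_square[OF Z])
  have WH: "W \<in> H" unfolding W_def by (intro H_add H_diff H_scale H_square Z H_const D)
  have le: "W \<omega> \<le> l * exp (- (y\<^sup>2 * (\<xi> + a * Z \<omega> / y\<^sup>2)\<^sup>2 / (2 * \<sigma>\<^sup>2 * T))) - c" for \<omega>
  proof -
    let ?x = "Z \<omega>"
    have "exp R * q * (a\<^sup>2 * ?x\<^sup>2) \<le> exp R * q0 * (a\<^sup>2 * ?x\<^sup>2)"
      using q by (intro mult_right_mono mult_left_mono) auto
    moreover have "K * a\<^sup>2 * (?x\<^sup>2 * min 1 (a * \<bar>?x\<bar>)) \<le> K * a\<^sup>2 * (sqrt a * ?x\<^sup>2 + 2 * D \<omega>)"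
      using square_times_min_le[OF pos(2), of ?x] K unfolding D_def by (intro mult_left_mono) auto
    ultimately have "1 + a * p * ?x + (a * p * ?x)\<^sup>2 / 2 - exp R * q0 * (a\<^sup>2 * ?x\<^sup>2)
        - K * a\<^sup>2 * (sqrt a * ?x\<^sup>2 + 2 * D \<omega>) \<le> exp (a * p * ?x - q * (a\<^sup>2 * ?x\<^sup>2))"
      using exp_ge_quadratic_minus_truncated[OF pos(2) p q(1), of ?x] unfolding K_def[symmetric]
      by linarith
    then have "l * G * (1 + a * p * ?x + (a * p * ?x)\<^sup>2 / 2 - exp R * q0 * (a\<^sup>2 * ?x\<^sup>2)
        - K * a\<^sup>2 * (sqrt a * ?x\<^sup>2 + 2 * D \<omega>)) \<le> l * G * exp (a * p * ?x - q * (a\<^sup>2 * ?x\<^sup>2))"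
      using pos G by (intro mult_left_mono) auto
    moreover have "W \<omega> = l * G * (1 + a * p * ?x + (a * p * ?x)\<^sup>2 / 2 - exp R * q0 * (a\<^sup>2 * ?x\<^sup>2)
        - K * a\<^sup>2 * (sqrt a * ?x\<^sup>2 + 2 * D \<omega>)) - c"
      by (simp add: W_def e1_def e2_def algebra_simps power_mult_distrib)
    \<comment> \<open>Expanding the square is exact: the exponent is its value at
      \<open>\<xi>\<close>, the logarithm of \<open>G\<close>, plus a linear and a concave term in
      \<open>Z\<close>.\<close>
    moreover have "y\<^sup>2 * (\<xi> + a * ?x / y\<^sup>2)\<^sup>2 / (2 * \<sigma>\<^sup>2 * T)
        = y\<^sup>2 * \<xi>\<^sup>2 / (2 * \<sigma>\<^sup>2 * T) - (a * p * ?x - q * (a\<^sup>2 * ?x\<^sup>2))"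
      using pos T unfolding p_def q_def by (simp add: field_simps power2_eq_square)
    then have "exp (- (y\<^sup>2 * (\<xi> + a * ?x / y\<^sup>2)\<^sup>2 / (2 * \<sigma>\<^sup>2 * T)))
        = G * exp (a * p * ?x - q * (a\<^sup>2 * ?x\<^sup>2))"
      by (simp add: G_def flip: exp_add)
    ultimately show ?thesis by (simp add: mult.assoc)
  qed
  have r: "0 \<le> r" "r \<le> R\<^sup>2 * \<sigma>\<^sup>2 / 2"
  proof -
    have "p\<^sup>2 \<le> R\<^sup>2" using power_mono[OF p, of 2] by simp
    then show "0 \<le> r" "r \<le> R\<^sup>2 * \<sigma>\<^sup>2 / 2" by (auto simp: r_def mult.commute[of "\<sigma>\<^sup>2"] intro: mult_right_mono)
  qed
  have \<eta>0: "0 \<le> \<eta>" unfolding \<eta>_def q0_def[symmetric] using K q0 nn pos by auto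
  have e: "exp (a\<^sup>2 * (r - \<delta>)) \<le> 1 + a\<^sup>2 * (r - \<eta>)"
    by (intro exp_compare[OF _ r \<eta>0 \<eta>] pos small) auto
  \<comment> \<open>The Hamilton-Jacobi equation as an inequality: since
    \<open>1 / T - 1 / (T + h) \<le> h / T\<^sup>2\<close>, lengthening \<open>T\<close> by
    \<open>h = a\<^sup>2 / y\<^sup>2\<close> raises the exponent by at most
    \<open>a\<^sup>2 * r\<close>, where \<open>r\<close> is the Hamiltonian at the slope
    \<open>p\<close>.\<close>
  have "G * exp (a\<^sup>2 * r) \<ge> exp (- (y\<^sup>2 * \<xi>\<^sup>2 / (2 * \<sigma>\<^sup>2 * (T + a\<^sup>2 / y\<^sup>2))))"
  proof -
    define h where "h = a\<^sup>2 / y\<^sup>2"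
    have h: "0 < h" "a\<^sup>2 = h * y\<^sup>2" using pos by (auto simp: h_def)
    have "1 / T - 1 / (T + h) = h / (T * (T + h))" using T h by (simp add: field_simps)
    also have "\<dots> \<le> h / (T * T)" using T h by (intro divide_left_mono mult_left_mono) auto
    finally have "y\<^sup>2 * \<xi>\<^sup>2 / (2 * \<sigma>\<^sup>2) * (1 / T - 1 / (T + h)) \<le> y\<^sup>2 * \<xi>\<^sup>2 / (2 * \<sigma>\<^sup>2) * (h / (T * T))"
      by (intro mult_left_mono) auto
    also have "\<dots> = a\<^sup>2 * r"
      unfolding r_def p_def h(2) using T \<sigma>2 by (simp add: field_simps power2_eq_square)
    also have "y\<^sup>2 * \<xi>\<^sup>2 / (2 * \<sigma>\<^sup>2) * (1 / T - 1 / (T + h))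
        = y\<^sup>2 * \<xi>\<^sup>2 / (2 * \<sigma>\<^sup>2 * T) - y\<^sup>2 * \<xi>\<^sup>2 / (2 * \<sigma>\<^sup>2 * (T + h))"
      by (simp add: right_diff_distrib)
    finally show ?thesis unfolding G_def h_def[symmetric] by (simp flip: exp_add)
  qed
  then have "l * exp (- \<delta> * a\<^sup>2) * exp (- (y\<^sup>2 * \<xi>\<^sup>2 / (2 * \<sigma>\<^sup>2 * (T + a\<^sup>2 / y\<^sup>2))))
      \<le> l * exp (- \<delta> * a\<^sup>2) * (G * exp (a\<^sup>2 * r))"
    using pos by (intro mult_left_mono) auto
  also have "\<dots> = l * G * exp (a\<^sup>2 * (r - \<delta>))"
    by (simp add: algebra_simps flip: exp_add)
  also have "\<dots> \<le> l * G * (1 + a\<^sup>2 * (r - \<eta>))"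
    using e pos G by (intro mult_left_mono) auto
  \<comment> \<open>\<open>\<eta>\<close> is the total cost \<open>e1 * V + e2 * \<theta>\<close> of
    the error terms, divided by \<open>l * G * a\<^sup>2\<close>.\<close>
  also have "\<dots> = l * G + (l * G * a\<^sup>2 * p\<^sup>2 / 2) * \<sigma>\<^sup>2 - e1 * V - e2 * \<theta>"
    unfolding e1_def e2_def r_def \<eta>_def q0_def[symmetric] by (simp add: algebra_simps)
  finally have "ereal (l * exp (- \<delta> * a\<^sup>2) * exp (- (y\<^sup>2 * \<xi>\<^sup>2 / (2 * \<sigma>\<^sup>2 * (T + a\<^sup>2 / y\<^sup>2)))) - c)
      \<le> ereal ((l * G - c) + (l * G * a\<^sup>2 * p\<^sup>2 / 2) * \<sigma>\<^sup>2 - e1 * V - e2 * \<theta>)" by simp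
  also have "\<dots> \<le> F W"
    unfolding W_def using pos G K q0
    by (intro functional_quadratic_ge F Z mean V s D \<theta>[folded D_def])
      (auto simp: e1_def e2_def)
  finally show ?thesis using WH le by blast
qed

text \<open>The subsolution stays below the iterates of the transition operator, by induction on the
  number of steps. Beyond the radius \<open>\<rho>\<close> the kernel does not exceed the subtracted
  constant at any time up to \<open>1 + \<tau>\<close>, so the one-step estimate is needed only for
  slopes bounded by \<open>R\<close>.\<close>

lemma functional_iid_sum_ge:
  fixes a b y \<tau> \<rho> \<sigma> \<delta> P V \<theta> R K \<eta> :: real
  defines "\<rho> \<equiv> sqrt (2 * \<sigma>\<^sup>2 * (1 + \<tau>) * P)"
  defines "R \<equiv> \<rho> / (\<sigma>\<^sup>2 * \<tau>)"
  defines "K \<equiv> 1 + R + R\<^sup>2 + exp R * R ^ 3"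
  defines "\<eta> \<equiv> (exp R * (1 / (2 * \<sigma>\<^sup>2 * \<tau> * y\<^sup>2)) + K * sqrt a) * V + 2 * K * \<theta>"
  assumes F: "F \<in> {E, conjugate_expectation E}" and iid: "iid_sequence H E X"
    and mean: "E (X 1) = 0" "E (\<lambda>\<omega>. - X 1 \<omega>) = 0"
    and V: "E (\<lambda>\<omega>. (X 1 \<omega>)\<^sup>2) = ereal V" and s: "F (\<lambda>\<omega>. (X 1 \<omega>)\<^sup>2) = ereal (\<sigma>\<^sup>2)"
    and \<theta>: "E (\<lambda>\<omega>. max ((X 1 \<omega>)\<^sup>2 - 1 / (2 * a)) 0) = ereal \<theta>"
    and pos: "0 < \<sigma>" "0 < y" "0 < \<tau>" "0 < \<delta>" "0 < P" and nn: "0 \<le> V" "0 \<le> \<theta>"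
    and n: "1 \<le> n" and a: "a = y / sqrt (real n)"
    and \<eta>: "\<eta> \<le> \<delta> / 2"
    and small: "a\<^sup>2 * (R\<^sup>2 * \<sigma>\<^sup>2 / 2 + \<delta>)\<^sup>2 \<le> \<delta> / 2" "a\<^sup>2 * (R\<^sup>2 * \<sigma>\<^sup>2 / 2 + \<delta>) < 1"
    and g: "L-lipschitz_on UNIV g" "\<And>x. \<bar>g x\<bar> \<le> B" "\<And>x. 0 \<le> g x"
    and ge: "\<And>s. exp (- (y\<^sup>2 * (s / (y * sqrt (real n)) - b)\<^sup>2 / (2 * \<sigma>\<^sup>2 * \<tau>))) - exp (- (y\<^sup>2 * P)) \<le> g s"
  shows "ereal (exp (- \<delta> * y\<^sup>2) * exp (- (y\<^sup>2 * b\<^sup>2 / (2 * \<sigma>\<^sup>2 * (\<tau> + 1)))) - exp (- (y\<^sup>2 * P)))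
    \<le> F (\<lambda>\<omega>. g (\<Sum>k=1..n. X k \<omega>))"
proof -
  have Z: "X 1 \<in> H" using iid by (auto simp: iid_sequence_def)
  have n0: "0 < real n" using n by simp
  have a0: "0 < a" using pos n0 by (simp add: a)
  have a2: "a\<^sup>2 / y\<^sup>2 = 1 / n" "a\<^sup>2 * n = y\<^sup>2"
    using pos n0 by (simp_all add: a power_divide)
  have ay: "a / y\<^sup>2 = 1 / (y * sqrt n)" using pos by (simp add: a power2_eq_square)
  let ?c = "exp (- (y\<^sup>2 * P))"
  let ?T = "transition F (X 1)"
  \<comment> \<open>After \<open>j\<close> steps the elapsed time is \<open>j / n\<close> and the
    accumulated loss is \<open>a\<^sup>2 * j = y\<^sup>2 * j / n\<close> times
    \<open>\<delta>\<close>.\<close>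
  have main: "exp (- \<delta> * (a\<^sup>2 * j)) *
      exp (- (y\<^sup>2 * (s / (y * sqrt n) - b)\<^sup>2 / (2 * \<sigma>\<^sup>2 * (\<tau> + j / n)))) - ?c
      \<le> (?T ^^ j) g s" if "j \<le> n" for j s
    using that
  proof (induction j arbitrary: s)
    case 0
    then show ?case using ge by simp
  next
    case (Suc j)
    define \<xi> where "\<xi> = s / (y * sqrt n) - b"
    define T where "T = \<tau> + j / n"
    have T: "\<tau> \<le> T" "T + a\<^sup>2 / y\<^sup>2 = \<tau> + Suc j / n"
      unfolding a2 by (auto simp: T_def add_divide_distrib)
    have T1: "T + a\<^sup>2 / y\<^sup>2 \<le> 1 + \<tau>"
      using Suc.prems n0 unfolding T(2) by (simp del: of_nat_Suc)
    note gj = transition_funpow[OF F Z g(1,2), of j]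
    define G where "G = (?T ^^ j) g"
    have Gl: "L-lipschitz_on UNIV G" and Gb: "\<bar>G x\<bar> \<le> B" for x using gj by (auto simp: G_def)
    have "exp (- \<delta> * (a\<^sup>2 * j)) * exp (- \<delta> * a\<^sup>2) *
        exp (- (y\<^sup>2 * \<xi>\<^sup>2 / (2 * \<sigma>\<^sup>2 * (T + a\<^sup>2 / y\<^sup>2)))) - ?c \<le> ?T G s"
    proof (cases "\<bar>\<xi>\<bar> \<le> \<rho>")
      case True
      obtain W where W: "W \<in> H"
        "ereal (exp (- \<delta> * (a\<^sup>2 * j)) * exp (- \<delta> * a\<^sup>2) *
          exp (- (y\<^sup>2 * \<xi>\<^sup>2 / (2 * \<sigma>\<^sup>2 * (T + a\<^sup>2 / y\<^sup>2)))) - ?c) \<le> F W"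
        "\<And>\<omega>. W \<omega> \<le> exp (- \<delta> * (a\<^sup>2 * j)) *
          exp (- (y\<^sup>2 * (\<xi> + a * X 1 \<omega> / y\<^sup>2)\<^sup>2 / (2 * \<sigma>\<^sup>2 * T))) - ?c"
        using functional_gaussian_step[OF F Z mean V s \<theta> pos(1) a0 pos(2,3) T(1) pos(4) _ nn True
            \<eta>[unfolded \<eta>_def K_def R_def] small[unfolded R_def], of "exp (- \<delta> * (a\<^sup>2 * j))" ?c]
        by auto
      show ?thesis
      proof (rule transition_mono[OF F Z Gl Gb W(1,2)])
        fix \<omega>
        have "\<xi> + a * X 1 \<omega> / y\<^sup>2 = (s + X 1 \<omega>) / (y * sqrt n) - b"
          using ay by (simp add: \<xi>_def add_divide_distrib) (metis mult.left_neutral times_divide_eq_left)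
        then show "W \<omega> \<le> G (s + X 1 \<omega>)"
          using W(3)[of \<omega>] Suc.IH[of "s + X 1 \<omega>"] Suc.prems unfolding G_def T_def by simp
      qed
    next
      case False
      let ?T' = "T + a\<^sup>2 / y\<^sup>2"
      have T': "0 < ?T'" using T pos by (simp add: add_pos_nonneg)
      have rad: "0 \<le> 2 * \<sigma>\<^sup>2 * (1 + \<tau>) * P" using pos by simp
      have "\<rho>\<^sup>2 \<le> \<bar>\<xi>\<bar>\<^sup>2" using False rad by (intro power_mono) (auto simp: \<rho>_def)
      then have "P * (2 * \<sigma>\<^sup>2 * (1 + \<tau>)) \<le> \<xi>\<^sup>2"
        using rad by (simp add: \<rho>_def mult.commute)
      moreover have "P * (2 * \<sigma>\<^sup>2 * ?T') \<le> P * (2 * \<sigma>\<^sup>2 * (1 + \<tau>))"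
        using T1 pos by (intro mult_left_mono) auto
      ultimately have "P * (2 * \<sigma>\<^sup>2 * ?T') \<le> \<xi>\<^sup>2" by (rule order_trans[rotated])
      moreover have "0 < 2 * \<sigma>\<^sup>2 * ?T'" using T' pos by simp
      ultimately have "P \<le> \<xi>\<^sup>2 / (2 * \<sigma>\<^sup>2 * ?T')" using pos_le_divide_eq by blast
      then have "y\<^sup>2 * P \<le> y\<^sup>2 * \<xi>\<^sup>2 / (2 * \<sigma>\<^sup>2 * ?T')"
        using mult_left_mono[of P "\<xi>\<^sup>2 / (2 * \<sigma>\<^sup>2 * ?T')" "y\<^sup>2"] by simp
      then have "exp (- (y\<^sup>2 * \<xi>\<^sup>2 / (2 * \<sigma>\<^sup>2 * ?T'))) \<le> ?c" by simp
      moreover have "exp (- \<delta> * (a\<^sup>2 * j)) * exp (- \<delta> * a\<^sup>2) \<le> 1"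
        using pos by (simp add: mult_le_one)
      ultimately have "exp (- \<delta> * (a\<^sup>2 * j)) * exp (- \<delta> * a\<^sup>2) *
          exp (- (y\<^sup>2 * \<xi>\<^sup>2 / (2 * \<sigma>\<^sup>2 * ?T'))) \<le> 1 * ?c"
        by (intro mult_mono) auto
      \<comment> \<open>Outside the radius the left side is nonpositive, so positivity of the
        iterates finishes the case.\<close>
      moreover have "0 \<le> ?T G s"
      proof (rule transition_mono[OF F Z Gl Gb H_zero])
        show "ereal 0 \<le> F (\<lambda>_. 0)" using functional_const[OF F] by simp
        show "0 \<le> G (s + X 1 \<omega>)" for \<omega>
        proof -
          have "0 \<le> (?T ^^ i) g x" for i x
          proof (induction i arbitrary: x)
            case (Suc i)
            have t: "L-lipschitz_on UNIV ((?T ^^ i) g)" "\<And>x. \<bar>(?T ^^ i) g x\<bar> \<le> B"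
              using transition_funpow[OF F Z g(1,2), of i] by auto
            show ?case unfolding funpow.simps comp_def
              by (rule transition_mono[OF F Z t H_zero _ Suc])
                (simp add: functional_const[OF F])
          qed (simp add: g)
          then show ?thesis by (simp add: G_def)
        qed
      qed
      ultimately show ?thesis by simp
    qed
    moreover have "exp (- \<delta> * (a\<^sup>2 * j)) * exp (- \<delta> * a\<^sup>2) = exp (- \<delta> * (a\<^sup>2 * Suc j))"
      by (simp add: algebra_simps flip: exp_add)
    ultimately show ?case unfolding T(2) by (simp add: G_def \<xi>_def)
  qed
  \<comment> \<open>The invariant at \<open>j = n\<close>, started from the empty sum
    \<open>s = 0\<close>, where the distance to \<open>b\<close> is
    \<open>\<bar>b\<bar>\<close>.\<close>
  have "exp (- \<delta> * y\<^sup>2) * exp (- (y\<^sup>2 * b\<^sup>2 / (2 * \<sigma>\<^sup>2 * (\<tau> + 1)))) - ?c \<le> (?T ^^ n) g 0"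
    using main[of n 0] n0 unfolding a2(2) by simp
  then show ?thesis using functional_iid_sum[OF F iid g(1,2), of n] by simp
qed

section \<open>Choice of parameters and passage to the limit\<close>

lemma moderate_deviation_lower_bound:
  fixes X :: "nat \<Rightarrow> 'a \<Rightarrow> real" and b \<epsilon> \<delta> \<sigma> V :: real
  assumes F: "F \<in> {E, conjugate_expectation E}" and iid: "iid_sequence H E X"
    and mean: "E (X 1) = 0" "E (\<lambda>\<omega>. - X 1 \<omega>) = 0"
    and V: "E (\<lambda>\<omega>. (X 1 \<omega>)\<^sup>2) = ereal V" and s: "F (\<lambda>\<omega>. (X 1 \<omega>)\<^sup>2) = ereal (\<sigma>\<^sup>2)"
    and tail: "((\<lambda>c::real. E (\<lambda>\<omega>. max ((X 1 \<omega>)\<^sup>2 - c) 0)) \<longlongrightarrow> 0) at_top"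
    and y_pos: "\<And>n. n \<ge> 1 \<Longrightarrow> y n > 0"
    and y_at_top: "filterlim y at_top sequentially"
    and y_small: "(\<lambda>n. y n / sqrt (real n)) \<longlonglongrightarrow> 0"
    and pos: "0 < \<sigma>" "0 < \<epsilon>" "0 < \<delta>"
  shows "\<exists>n0. \<forall>n\<ge>n0. \<exists>g L. L-lipschitz_on UNIV g \<and>
    (\<forall>x. 0 \<le> g x \<and> g x \<le> indicator {x. \<bar>x / (y n * sqrt (real n)) - b\<bar> \<le> \<epsilon>} x) \<and>
    ereal (exp (- ((\<bar>b\<bar> / \<sigma>)\<^sup>2 + \<delta>) * ((y n)\<^sup>2 / 2))) \<le> F (\<lambda>\<omega>. g (\<Sum>k=1..n. X k \<omega>))"
proof -
  have Z: "X 1 \<in> H" using iid by (auto simp: iid_sequence_def)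
  \<comment> \<open>The exponent \<open>P\<close> exceeds the leading rate by
    \<open>\<delta> / 4\<close>, while the subsolution will lose only \<open>\<delta> / 8\<close>;
    hence the subtracted constant is of smaller order.\<close>
  define P where "P = b\<^sup>2 / (2 * \<sigma>\<^sup>2) + \<delta> / 4"
  \<comment> \<open>Chosen so that the terminal kernel at distance \<open>\<epsilon> / 2\<close>
    from \<open>b\<close> equals the subtracted constant \<open>exp (-y\<^sup>2 P)\<close>.\<close>
  define \<tau> where "\<tau> = \<epsilon>\<^sup>2 / (8 * \<sigma>\<^sup>2 * P)"
  define \<rho> where "\<rho> = sqrt (2 * \<sigma>\<^sup>2 * (1 + \<tau>) * P)"
  define R where "R = \<rho> / (\<sigma>\<^sup>2 * \<tau>)"
  define K where "K = 1 + R + R\<^sup>2 + exp R * R ^ 3"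
  define a where "a n = y n / sqrt (real n)" for n
  define \<theta> where "\<theta> n = real_of_ereal (E (\<lambda>\<omega>. max ((X 1 \<omega>)\<^sup>2 - 1 / (2 * a n)) 0))" for n
  define \<eta> where
    "\<eta> n = (exp R * (1 / (2 * \<sigma>\<^sup>2 * \<tau> * (y n)\<^sup>2)) + K * sqrt (a n)) * V + 2 * K * \<theta> n" for n
  have P: "0 < P" using pos by (simp add: P_def add_nonneg_pos)
  have \<tau>: "0 < \<tau>" using pos P by (simp add: \<tau>_def)
  have a0: "0 < a n" if "1 \<le> n" for n using y_pos[OF that] that by (simp add: a_def)
  have V0: "0 \<le> V"
    using E_mono[OF H_square[OF Z] H_zero] E_const[of 0] V by simp
  have \<theta>n: "E (\<lambda>\<omega>. max ((X 1 \<omega>)\<^sup>2 - 1 / (2 * a n)) 0) = ereal (\<theta> n)" "0 \<le> \<theta> n" if "1 \<le> n" for n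
  proof -
    let ?D = "\<lambda>\<omega>. max ((X 1 \<omega>)\<^sup>2 - 1 / (2 * a n)) 0"
    have "0 < 1 / (2 * a n)" using a0[OF that] by simp
    then have "?D \<omega> \<le> (X 1 \<omega>)\<^sup>2" for \<omega>
      by (smt (verit) zero_le_power2)
    then have "E ?D \<le> ereal V"
      unfolding V[symmetric] by (intro E_mono H_square H_truncated_square Z)
    moreover have "0 \<le> E ?D"
      using E_mono[OF H_truncated_square[OF Z] H_zero, of "1 / (2 * a n)" 0] E_const[of 0] by (simp add: zero_ereal_def)
    ultimately show "E ?D = ereal (\<theta> n)" "0 \<le> \<theta> n"
      unfolding \<theta>_def by (cases "E ?D"; simp)+
  qed
  have a_lim: "a \<longlonglongrightarrow> 0" using y_small by (simp add: a_def[abs_def])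
  \<comment> \<open>The truncation level tends to infinity, which brings in the tail
    condition.\<close>
  have "filterlim (\<lambda>n. 1 / (2 * a n)) at_top sequentially"
  proof -
    have "(\<lambda>n. 2 * a n) \<longlonglongrightarrow> 0" using tendsto_mult_right_zero[OF a_lim] .
    moreover have "\<forall>\<^sub>F n in sequentially. 0 < 2 * a n"
      using eventually_ge_at_top[of 1] by eventually_elim (use a0 in auto)
    ultimately have "filterlim (\<lambda>n. inverse (2 * a n)) at_top sequentially"
      by (rule filterlim_inverse_at_top)
    then show ?thesis by (simp only: inverse_eq_divide)
  qed
  from lim_real_of_ereal[OF filterlim_compose[OF tail this, unfolded zero_ereal_def]]
  have \<theta>_lim: "\<theta> \<longlonglongrightarrow> 0" by (simp add: \<theta>_def[abs_def])
  have y2: "filterlim (\<lambda>n. (y n)\<^sup>2) at_top sequentially"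
    by (rule filterlim_pow_at_top[OF _ y_at_top]) simp
  have "(\<lambda>n. 1 / (2 * \<sigma>\<^sup>2 * \<tau> * (y n)\<^sup>2)) \<longlonglongrightarrow> 0"
    by (rule tendsto_divide_0[OF tendsto_const filterlim_at_top_imp_at_infinity])
      (use pos \<tau> in \<open>intro filterlim_tendsto_pos_mult_at_top[OF tendsto_const _ y2]; simp\<close>)
  then have "\<eta> \<longlonglongrightarrow> (exp R * 0 + K * sqrt 0) * V + 2 * K * 0"
    unfolding \<eta>_def[abs_def] by (intro tendsto_intros a_lim \<theta>_lim)
  then have "\<eta> \<longlonglongrightarrow> 0" by simp
  then have ev\<eta>: "\<forall>\<^sub>F n in sequentially. \<eta> n < \<delta> / 8 / 2"
    using pos by (intro order_tendstoD(2)) auto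
  have a2: "(\<lambda>n. (a n)\<^sup>2 * C) \<longlonglongrightarrow> 0" for C
    using tendsto_mult_left_zero[OF tendsto_null_power[OF a_lim, of 2], of C] by simp
  define C where "C = R\<^sup>2 * \<sigma>\<^sup>2 / 2 + \<delta> / 8"
  have ev1: "\<forall>\<^sub>F n in sequentially. (a n)\<^sup>2 * C\<^sup>2 < \<delta> / 8 / 2"
    using pos by (intro order_tendstoD(2)[OF a2]) auto
  have ev2: "\<forall>\<^sub>F n in sequentially. (a n)\<^sup>2 * C < 1"
    by (intro order_tendstoD(2)[OF a2]) auto
  have evy: "\<forall>\<^sub>F n in sequentially. 8 / \<delta> \<le> (y n)\<^sup>2"
    using y2 by (simp add: filterlim_at_top)
  have "\<forall>\<^sub>F n in sequentially. \<exists>g L. L-lipschitz_on UNIV g \<and>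
    (\<forall>x. 0 \<le> g x \<and> g x \<le> indicator {x. \<bar>x / (y n * sqrt (real n)) - b\<bar> \<le> \<epsilon>} x) \<and>
    ereal (exp (- ((\<bar>b\<bar> / \<sigma>)\<^sup>2 + \<delta>) * ((y n)\<^sup>2 / 2))) \<le> F (\<lambda>\<omega>. g (\<Sum>k=1..n. X k \<omega>))"
    using eventually_ge_at_top[of 1] ev\<eta> ev1 ev2 evy
  proof eventually_elim
    case (elim n)
    define N where "N = y n * sqrt (real n)"
    \<comment> \<open>A trapezoid: 1 up to distance \<open>\<epsilon> / 2\<close> from
      \<open>b\<close>, then linear, and 0 from distance \<open>\<epsilon>\<close> on.\<close>
    define g where "g x = max 0 (min 1 (2 - 2 / \<epsilon> * \<bar>x / N - b\<bar>))" for x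
    \<comment> \<open>In units of \<open>u\<close>, the exponents beyond the leading rate are 1 for
      the kernel bound \<open>A\<close>, 2 for the subtracted constant and 4 for the target.\<close>
    define u where "u = (y n)\<^sup>2 * \<delta> / 8"
    have N: "0 < N" using y_pos[of n] elim(1) by (simp add: N_def)
    have y: "0 < y n" using y_pos elim(1) by simp
    have gL: "(2 / (\<epsilon> * N))-lipschitz_on UNIV g"
    proof (rule lipschitz_onI)
      fix x z :: real
      have "\<bar>g x - g z\<bar> \<le> \<bar>2 / \<epsilon> * \<bar>x / N - b\<bar> - 2 / \<epsilon> * \<bar>z / N - b\<bar>\<bar>"
        unfolding g_def by linarith
      also have "\<dots> = 2 / \<epsilon> * \<bar>\<bar>x / N - b\<bar> - \<bar>z / N - b\<bar>\<bar>"
      proof -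
        have "0 \<le> 2 / \<epsilon>" using pos by simp
        then show ?thesis by (metis abs_mult abs_of_nonneg right_diff_distrib)
      qed
      also have "\<dots> \<le> 2 / \<epsilon> * \<bar>(x - z) / N\<bar>"
        using pos by (intro mult_left_mono) (auto simp: diff_divide_distrib)
      also have "\<dots> = 2 / (\<epsilon> * N) * \<bar>x - z\<bar>" using N by simp
      finally show "dist (g x) (g z) \<le> 2 / (\<epsilon> * N) * dist x z" by (simp add: dist_real_def)
    qed (use pos N in simp)
    have g0: "0 \<le> g x" and g1: "\<bar>g x\<bar> \<le> 1" for x by (auto simp: g_def)
    have gi: "g x \<le> indicator {x. \<bar>x / N - b\<bar> \<le> \<epsilon>} x" for x
    proof (cases "\<bar>x / N - b\<bar> \<le> \<epsilon>")
      case True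
      then show ?thesis using g1[of x] by simp
    next
      case False
      then have "2 \<le> 2 / \<epsilon> * \<bar>x / N - b\<bar>" using pos by (simp add: field_simps)
      then show ?thesis using False by (simp add: g_def)
    qed
    have ge: "exp (- ((y n)\<^sup>2 * (x / N - b)\<^sup>2 / (2 * \<sigma>\<^sup>2 * \<tau>))) - exp (- ((y n)\<^sup>2 * P)) \<le> g x" for x
    proof (cases "\<bar>x / N - b\<bar> \<le> \<epsilon> / 2")
      case True
      then have "2 / \<epsilon> * \<bar>x / N - b\<bar> \<le> 1" using pos by (simp add: field_simps)
      then have "g x = 1" by (simp add: g_def)
      moreover have "exp (- ((y n)\<^sup>2 * (x / N - b)\<^sup>2 / (2 * \<sigma>\<^sup>2 * \<tau>))) \<le> 1"
        using \<tau> by simp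
      ultimately show ?thesis by (smt (verit) exp_gt_zero)
    next
      case False
      have "(\<epsilon> / 2)\<^sup>2 \<le> \<bar>x / N - b\<bar>\<^sup>2" using False pos by (intro power_mono) auto
      then have "(y n)\<^sup>2 * ((\<epsilon> / 2)\<^sup>2 / (2 * \<sigma>\<^sup>2 * \<tau>)) \<le> (y n)\<^sup>2 * ((x / N - b)\<^sup>2 / (2 * \<sigma>\<^sup>2 * \<tau>))"
        using \<tau> by (intro mult_left_mono divide_right_mono) auto
      moreover have "(\<epsilon> / 2)\<^sup>2 / (2 * \<sigma>\<^sup>2 * \<tau>) = P"
        using pos P unfolding \<tau>_def by (simp add: field_simps power2_eq_square)
      ultimately have "exp (- ((y n)\<^sup>2 * (x / N - b)\<^sup>2 / (2 * \<sigma>\<^sup>2 * \<tau>))) \<le> exp (- ((y n)\<^sup>2 * P))"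
        by simp
      then show ?thesis using g0[of x] by linarith
    qed
    have bound: "ereal (exp (- (\<delta> / 8) * (y n)\<^sup>2) * exp (- ((y n)\<^sup>2 * b\<^sup>2 / (2 * \<sigma>\<^sup>2 * (\<tau> + 1))))
        - exp (- ((y n)\<^sup>2 * P))) \<le> F (\<lambda>\<omega>. g (\<Sum>k=1..n. X k \<omega>))"
      by (rule functional_iid_sum_ge[OF F iid mean V s \<theta>n(1)[OF elim(1)] pos(1) y \<tau> _ P V0
            \<theta>n(2)[OF elim(1)] elim(1) a_def _ _ _ gL g1 g0 ge[unfolded N_def]])
        (use elim pos in \<open>simp_all add: C_def \<eta>_def K_def R_def \<rho>_def\<close>)
    define A where "A = exp (- ((y n)\<^sup>2 * (b\<^sup>2 / (2 * \<sigma>\<^sup>2)) + u))"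
    \<comment> \<open>With \<open>u \<ge> 1\<close> both \<open>exp (- u)\<close> and
      \<open>exp (- (3 * u))\<close> are at most 1/2, so what is left after the subtraction still
      exceeds the target \<open>A * exp (- (3 * u))\<close>.\<close>
    have u: "1 \<le> u" using elim(5) pos by (simp add: u_def field_simps)
    have "exp (- u) \<le> exp (- 1)" "exp (- (3 * u)) \<le> exp (- u)" using u by auto
    moreover have "exp (- 1) \<le> (1 / 2 :: real)"
      using exp_ge_add_one_self[of "1::real"] by (simp add: exp_minus field_simps)
    ultimately have "exp (- (3 * u)) \<le> 1 - exp (- u)" by linarith
    then have "A * exp (- (3 * u)) \<le> A * (1 - exp (- u))"
      by (intro mult_left_mono) (auto simp: A_def)
    also have "\<dots> = A - exp (- ((y n)\<^sup>2 * P))"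
      by (simp add: A_def P_def u_def algebra_simps flip: exp_add)
    also have "A \<le> exp (- (\<delta> / 8) * (y n)\<^sup>2) * exp (- ((y n)\<^sup>2 * b\<^sup>2 / (2 * \<sigma>\<^sup>2 * (\<tau> + 1))))"
    proof -
      have "(y n)\<^sup>2 * b\<^sup>2 / (2 * \<sigma>\<^sup>2 * (\<tau> + 1)) \<le> (y n)\<^sup>2 * b\<^sup>2 / (2 * \<sigma>\<^sup>2 * 1)"
        using pos \<tau> by (intro divide_left_mono mult_left_mono) auto
      then show ?thesis by (simp add: A_def u_def mult.commute[of \<delta>] flip: exp_add)
    qed
    also have "A * exp (- (3 * u)) = exp (- ((\<bar>b\<bar> / \<sigma>)\<^sup>2 + \<delta>) * ((y n)\<^sup>2 / 2))"
      by (simp add: A_def u_def power_divide algebra_simps flip: exp_add)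
    finally have "ereal (exp (- ((\<bar>b\<bar> / \<sigma>)\<^sup>2 + \<delta>) * ((y n)\<^sup>2 / 2))) \<le> F (\<lambda>\<omega>. g (\<Sum>k=1..n. X k \<omega>))"
      by (intro order_trans[OF _ bound]) simp
    then show ?case using gL g0 gi unfolding N_def by blast
  qed
  then show ?thesis by (simp add: eventually_sequentially)
qed

section \<open>From test functions to capacities\<close>

lemma upper_capacity_ge:
  assumes "Y \<in> H" "\<And>\<omega>. \<omega> \<in> space M \<Longrightarrow> Y \<omega> \<le> indicator A \<omega>"
  shows "E Y \<le> upper_capacity M H E A"
  unfolding upper_capacity_def
  by (rule Inf_greatest) (use assms order_trans in \<open>force intro!: E_mono\<close>)

text \<open>The function \<open>1 - Y\<close> dominates the indicator of the complement and so
  competes in the infimum defining its upper capacity.\<close>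

lemma lower_capacity_ge:
  assumes Y: "Y \<in> H" "\<And>\<omega>. \<bar>Y \<omega>\<bar> \<le> B"
    and le: "\<And>\<omega>. \<omega> \<in> space M \<Longrightarrow> Y \<omega> \<le> indicator A \<omega>"
  shows "conjugate_expectation E Y \<le> lower_capacity M H E A"
proof -
  have H: "(\<lambda>\<omega>. - Y \<omega> + 1) \<in> H" by (intro H_add H_uminus Y H_const)
  have "upper_capacity M H E (space M - A) \<le> E (\<lambda>\<omega>. - Y \<omega> + 1)"
    unfolding upper_capacity_def
  proof (rule Inf_lower, rule CollectI, intro exI conjI ballI)
    show "indicator (space M - A) \<omega> \<le> - Y \<omega> + 1" if "\<omega> \<in> space M" for \<omega>
      using le[OF that] that by (auto split: split_indicator_asm split_indicator)
  qed (use H in auto)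
  also have "\<dots> \<le> E (\<lambda>\<omega>. - Y \<omega>) + ereal 1"
    by (intro E_add_finite H_uminus Y H_const E_const)
  finally show ?thesis
    using E_bounded(1)[OF H_uminus[OF Y(1)], of B] Y(2)
    unfolding conjugate_expectation_def lower_capacity_def one_ereal_def
    by (cases "E (\<lambda>\<omega>. - Y \<omega>)"; cases "upper_capacity M H E (space M - A)") auto
qed

end

theorem theorem3p3:
  fixes M :: "'a measure"
    and H :: "('a \<Rightarrow> real) set"
    and E :: "('a \<Rightarrow> real) \<Rightarrow> ereal"
    and X :: "nat \<Rightarrow> 'a \<Rightarrow> real"
    and S :: "nat \<Rightarrow> 'a \<Rightarrow> real"
    and y :: "nat \<Rightarrow> real"
    and \<sigma>_up \<sigma>_lo :: real
  assumes sublinear: "sublinear_expectation_space M H E"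
    and iid: "iid_sequence H E X"
    and mean: "E (X 1) = 0" "E (\<lambda>\<omega>. - X 1 \<omega>) = 0"
    and tail: "((\<lambda>c::real. E (\<lambda>\<omega>. max ((X 1 \<omega>)\<^sup>2 - c) 0)) \<longlongrightarrow> 0) at_top"
    and S: "\<And>n \<omega>. S n \<omega> = (\<Sum>k=1..n. X k \<omega>)"
    and sigma_up: "\<sigma>_up \<ge> 0" "ereal (\<sigma>_up\<^sup>2) = E (\<lambda>\<omega>. (X 1 \<omega>)\<^sup>2)"
    and sigma_lo: "\<sigma>_lo \<ge> 0" "ereal (\<sigma>_lo\<^sup>2) = conjugate_expectation E (\<lambda>\<omega>. (X 1 \<omega>)\<^sup>2)"
    and y_pos: "\<And>n. n \<ge> 1 \<Longrightarrow> y n > 0"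
    and y_at_top: "filterlim y at_top sequentially"
    and y_small: "(\<lambda>n. y n / sqrt (real n)) \<longlonglongrightarrow> 0"
  shows "(\<forall>b \<epsilon> \<delta> :: real. \<bar>b\<bar> < \<sigma>_lo \<and> \<epsilon> > 0 \<and> \<delta> > 0 \<and> (b / \<sigma>_lo)\<^sup>2 + \<delta> < 1 \<longrightarrow>
           (\<exists>n0. \<forall>n\<ge>n0.
              lower_capacity M H E {\<omega> \<in> space M. \<bar>S n \<omega> / (y n * sqrt (real n)) - b\<bar> \<le> \<epsilon>}
                \<ge> ereal (exp (- ((\<bar>b\<bar> / \<sigma>_lo)\<^sup>2 + \<delta>) * ((y n)\<^sup>2 / 2))))) \<and>
         (\<forall>b \<epsilon> \<delta> :: real. \<bar>b\<bar> < \<sigma>_up \<and> \<epsilon> > 0 \<and> \<delta> > 0 \<and> (b / \<sigma>_up)\<^sup>2 + \<delta> < 1 \<longrightarrow>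
           (\<exists>n0. \<forall>n\<ge>n0.
              upper_capacity M H E {\<omega> \<in> space M. \<bar>S n \<omega> / (y n * sqrt (real n)) - b\<bar> \<le> \<epsilon>}
                \<ge> ereal (exp (- ((\<bar>b\<bar> / \<sigma>_up)\<^sup>2 + \<delta>) * ((y n)\<^sup>2 / 2)))))"
proof -
  interpret sublinear_expectation_space M H E by (rule sublinear)
  have S_H: "(\<lambda>\<omega>. \<Sum>k=1..n. X k \<omega>) \<in> H" for n
    using iid by (intro H_sum) (auto simp: iid_sequence_def)
  have bd: "\<bar>g x\<bar> \<le> 1" if "\<forall>x. 0 \<le> g x \<and> g x \<le> indicator A x" for g :: "real \<Rightarrow> real" and A x
    using that[rule_format, of x] by (auto split: split_indicator_asm)
  \<comment> \<open>Both claims are instances with different \<open>F\<close>. The error terms are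
    always measured by the upper second moment, and \<open>\<bar>b\<bar> < \<sigma>\<close> supplies
    the positivity of \<open>\<sigma>\<close>.\<close>
  have bound: "\<exists>n0. \<forall>n\<ge>n0. \<exists>g L. L-lipschitz_on UNIV g \<and>
      (\<forall>x. 0 \<le> g x \<and> g x \<le> indicator {x. \<bar>x / (y n * sqrt (real n)) - b\<bar> \<le> \<epsilon>} x) \<and>
      ereal (exp (- ((\<bar>b\<bar> / \<sigma>)\<^sup>2 + \<delta>) * ((y n)\<^sup>2 / 2))) \<le> F (\<lambda>\<omega>. g (\<Sum>k=1..n. X k \<omega>))"
    if "F \<in> {E, conjugate_expectation E}" "ereal (\<sigma>\<^sup>2) = F (\<lambda>\<omega>. (X 1 \<omega>)\<^sup>2)" "\<bar>b\<bar> < \<sigma>" "\<epsilon> > 0" "\<delta> > 0"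
    for F and b \<sigma> \<epsilon> \<delta> :: real
    by (rule moderate_deviation_lower_bound)
      (use that iid mean sigma_up(2)[symmetric] tail y_pos y_at_top y_small in auto)
  have lo: "\<exists>n0. \<forall>n\<ge>n0. ereal (exp (- ((\<bar>b\<bar> / \<sigma>_lo)\<^sup>2 + \<delta>) * ((y n)\<^sup>2 / 2)))
      \<le> lower_capacity M H E {\<omega> \<in> space M. \<bar>S n \<omega> / (y n * sqrt (real n)) - b\<bar> \<le> \<epsilon>}"
    if "\<bar>b\<bar> < \<sigma>_lo" "\<epsilon> > 0" "\<delta> > 0" for b \<epsilon> \<delta>
  proof -
    from bound[of "conjugate_expectation E" \<sigma>_lo b \<epsilon> \<delta>, OF _ sigma_lo(2) that] obtain n0 where
      n0: "\<forall>n\<ge>n0. \<exists>g L. L-lipschitz_on UNIV g \<and>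
        (\<forall>x. 0 \<le> g x \<and> g x \<le> indicator {x. \<bar>x / (y n * sqrt (real n)) - b\<bar> \<le> \<epsilon>} x) \<and>
        ereal (exp (- ((\<bar>b\<bar> / \<sigma>_lo)\<^sup>2 + \<delta>) * ((y n)\<^sup>2 / 2)))
          \<le> conjugate_expectation E (\<lambda>\<omega>. g (\<Sum>k=1..n. X k \<omega>))" by auto
    show ?thesis
    proof (intro exI allI impI)
      fix n assume "n0 \<le> n"
      with n0 obtain g L where L: "L-lipschitz_on UNIV g"
        and g: "\<forall>x. 0 \<le> g x \<and> g x \<le> indicator {x. \<bar>x / (y n * sqrt (real n)) - b\<bar> \<le> \<epsilon>} x"
        and ge: "ereal (exp (- ((\<bar>b\<bar> / \<sigma>_lo)\<^sup>2 + \<delta>) * ((y n)\<^sup>2 / 2)))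
          \<le> conjugate_expectation E (\<lambda>\<omega>. g (\<Sum>k=1..n. X k \<omega>))" by blast
      note ge
      also have "conjugate_expectation E (\<lambda>\<omega>. g (\<Sum>k=1..n. X k \<omega>))
        \<le> lower_capacity M H E {\<omega> \<in> space M. \<bar>S n \<omega> / (y n * sqrt (real n)) - b\<bar> \<le> \<epsilon>}"
        by (rule lower_capacity_ge[OF H_lipschitz[OF L S_H] bd[OF g]])
          (use g in \<open>auto simp: S indicator_def\<close>)
      finally show "ereal (exp (- ((\<bar>b\<bar> / \<sigma>_lo)\<^sup>2 + \<delta>) * ((y n)\<^sup>2 / 2)))
        \<le> lower_capacity M H E {\<omega> \<in> space M. \<bar>S n \<omega> / (y n * sqrt (real n)) - b\<bar> \<le> \<epsilon>}" .
    qed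
  qed
  have up: "\<exists>n0. \<forall>n\<ge>n0. ereal (exp (- ((\<bar>b\<bar> / \<sigma>_up)\<^sup>2 + \<delta>) * ((y n)\<^sup>2 / 2)))
      \<le> upper_capacity M H E {\<omega> \<in> space M. \<bar>S n \<omega> / (y n * sqrt (real n)) - b\<bar> \<le> \<epsilon>}"
    if "\<bar>b\<bar> < \<sigma>_up" "\<epsilon> > 0" "\<delta> > 0" for b \<epsilon> \<delta>
  proof -
    from bound[of E \<sigma>_up b \<epsilon> \<delta>, OF _ sigma_up(2) that] obtain n0 where
      n0: "\<forall>n\<ge>n0. \<exists>g L. L-lipschitz_on UNIV g \<and>
        (\<forall>x. 0 \<le> g x \<and> g x \<le> indicator {x. \<bar>x / (y n * sqrt (real n)) - b\<bar> \<le> \<epsilon>} x) \<and>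
        ereal (exp (- ((\<bar>b\<bar> / \<sigma>_up)\<^sup>2 + \<delta>) * ((y n)\<^sup>2 / 2)))
          \<le> E (\<lambda>\<omega>. g (\<Sum>k=1..n. X k \<omega>))" by auto
    show ?thesis
    proof (intro exI allI impI)
      fix n assume "n0 \<le> n"
      with n0 obtain g L where L: "L-lipschitz_on UNIV g"
        and g: "\<forall>x. 0 \<le> g x \<and> g x \<le> indicator {x. \<bar>x / (y n * sqrt (real n)) - b\<bar> \<le> \<epsilon>} x"
        and ge: "ereal (exp (- ((\<bar>b\<bar> / \<sigma>_up)\<^sup>2 + \<delta>) * ((y n)\<^sup>2 / 2)))
          \<le> E (\<lambda>\<omega>. g (\<Sum>k=1..n. X k \<omega>))" by blast
      note ge
      also have "E (\<lambda>\<omega>. g (\<Sum>k=1..n. X k \<omega>))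
        \<le> upper_capacity M H E {\<omega> \<in> space M. \<bar>S n \<omega> / (y n * sqrt (real n)) - b\<bar> \<le> \<epsilon>}"
        by (rule upper_capacity_ge[OF H_lipschitz[OF L S_H]])
          (use g in \<open>auto simp: S indicator_def\<close>)
      finally show "ereal (exp (- ((\<bar>b\<bar> / \<sigma>_up)\<^sup>2 + \<delta>) * ((y n)\<^sup>2 / 2)))
        \<le> upper_capacity M H E {\<omega> \<in> space M. \<bar>S n \<omega> / (y n * sqrt (real n)) - b\<bar> \<le> \<epsilon>}" .
    qed
  qed
  show ?thesis using lo up by blast
qed

end
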